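(* Let $n=1$ and $\alpha\in(2,3)$. Let $\{\beta_m\}_m\subseteq(1,\alpha)$ be such that $\beta_m\to2$, and define a sequence $\{\mu_m\}_m\subseteq\mathcal{P}(\mathbb{R}^n)$ by $\mu_m\in\operatorname{argmin}_{\mathcal{P}(\mathbb{R}^n)}\mathcal{E}_{\alpha,\beta_m}$. Then every subsequence of $\{\mu_m\}_m$ converges weakly to a measure with density as described in Frank's theorem, that is, to a measure whose density is that of a global minimizer of $\mathcal{E}_{\alpha,2}$.
   Context: $\mathcal{P}(\mathbb{R}^n)$ is the set of probability measures on $\mathbb{R}^n$ (here $n=1$); weak convergence is convergence against bounded continuous functions. For $\alpha>\beta>0$, $\mathcal{E}_{\alpha,\beta}[\mu]=\frac12\iint_{\mathbb{R}^n\times\mathbb{R}^n}\left(\frac{|x-y|^\alpha}{\alpha}-\frac{|x-y|^\beta}{\beta}\right)d\mu(x)d\mu(y)$, and $\operatorname{argmin}_{\mathcal{P}(\mathbb{R}^n)}\mathcal{E}_{\alpha,\beta}$ is the set of its global minimizers over $\mathcal{P}(\mathbb{R}^n)$. Frank's theorem: for $n=1$ and $\alpha\in(2,3)$, $\mathcal{E}_{\alpha,2}$ is minimized, uniquely up to translation and rotation, by a measure with an explicit density on an interval.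
   Formalization: Convergence is modulo translation: there are shifts a_m such that every subsequence of the translates of μ_m by a_m converges weakly to the centred Frank measure; without shifts the claim fails, since the energy is translation invariant and minimizers can be moved off to infinity. *)

theory Defs
  imports "HOL-Probability.Probability"
begin

definition prob_measures :: "'a::euclidean_space measure set" where
  "prob_measures = {\<mu>. prob_space \<mu> \<and> sets \<mu> = sets borel}"

definition kernel :: "real \<Rightarrow> real \<Rightarrow> 'a::euclidean_space \<times> 'a \<Rightarrow> real" where
  "kernel \<alpha> \<beta> = (\<lambda>(x, y). norm (x - y) powr \<alpha> / \<alpha> - norm (x - y) powr \<beta> / \<beta>)"

(* The double integral takes values in (-infinity, infinity], so it is defined as the integral of
   the positive part minus that of the negative part (ennreal truncates negative reals to 0)
   and not as a Bochner integral, which would give measures of infinite energy the value 0.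
   For 0 < \<beta> < \<alpha> the negative part is bounded by 1 / \<beta>, so the difference is never
   infinity - infinity. *)
definition energy :: "real \<Rightarrow> real \<Rightarrow> 'a::euclidean_space measure \<Rightarrow> ereal" where
  "energy \<alpha> \<beta> \<mu> = ereal (1 / 2) *
     (enn2ereal (\<integral>\<^sup>+ z. ennreal (kernel \<alpha> \<beta> z) \<partial>(\<mu> \<Otimes>\<^sub>M \<mu>))
      - enn2ereal (\<integral>\<^sup>+ z. ennreal (- kernel \<alpha> \<beta> z) \<partial>(\<mu> \<Otimes>\<^sub>M \<mu>)))"

definition minimizers :: "real \<Rightarrow> real \<Rightarrow> 'a::euclidean_space measure set" where
  "minimizers \<alpha> \<beta> = {\<mu>. is_arg_min (energy \<alpha> \<beta>) (\<lambda>\<nu>. \<nu> \<in> prob_measures) \<mu>}"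

(* The library's weak_conv_m is phrased through distribution functions on the line; this is
   convergence against bounded continuous functions. *)
definition weakly_converges ::
    "(nat \<Rightarrow> 'a::euclidean_space measure) \<Rightarrow> 'a measure \<Rightarrow> bool" where
  "weakly_converges \<mu> \<nu> \<longleftrightarrow>
     (\<forall>f :: 'a \<Rightarrow> real. continuous_on UNIV f \<and> bounded (range f) \<longrightarrow>
        (\<lambda>m. \<integral>x. f x \<partial>\<mu> m) \<longlonglongrightarrow> (\<integral>x. f x \<partial>\<nu>))"

definition translate :: "'a::euclidean_space \<Rightarrow> 'a measure \<Rightarrow> 'a measure" where
  "translate a \<mu> = distr \<mu> borel (\<lambda>x. x + a)"

(* Frank's density, centred at the origin: a multiple of (R^2 - x^2) powr ((1 - \<alpha>) / 2) on
   (-R, R). Differentiating the Euler-Lagrange equation for (\<alpha>, 2) twice gives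
   (\<alpha> - 1) * (integral of |x - y| powr (\<alpha> - 2) d\<mu>(y)) = 1 on the support, which fixes
   the constant; unit mass, i.e. frank_const * R powr (2 - \<alpha>) * Beta (1/2) ((3 - \<alpha>) / 2) = 1,
   then fixes R. *)
definition frank_const :: "real \<Rightarrow> real" where
  "frank_const \<alpha> = cos (pi * (\<alpha> - 2) / 2) / (pi * (\<alpha> - 1))"

definition frank_radius :: "real \<Rightarrow> real" where
  "frank_radius \<alpha> = (frank_const \<alpha> * Beta (1 / 2) ((3 - \<alpha>) / 2)) powr (1 / (\<alpha> - 2))"

definition frank_density :: "real \<Rightarrow> real \<Rightarrow> real" where
  "frank_density \<alpha> x =
     (if \<bar>x\<bar> < frank_radius \<alpha>
      then frank_const \<alpha> * ((frank_radius \<alpha>)\<^sup>2 - x\<^sup>2) powr ((1 - \<alpha>) / 2)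
      else 0)"

end

theory Submission
  imports Defs
begin

text \<open>
  On centred measures the quadratic part of the energy is linear: the double integral of
  \<open>\<bar>x - y\<bar>\<^sup>2\<close> against \<open>\<mu> \<otimes> \<nu>\<close> is the sum of the two second moments
  (\<open>powr_energy_two\<close>).  The other part is strictly convex there, since for \<open>2 < \<alpha> < 4\<close> the kernel
  \<open>\<bar>z\<bar> powr \<alpha>\<close> is, up to a positive constant, the integral over \<open>k > 0\<close> of
  \<open>(cos (k z) - 1 + (k z)\<^sup>2 / 2) k powr (- 1 - \<alpha>)\<close> (\<open>abs_powr_fourier\<close>).  Integrated against
  products of centred probability measures, everything but the product of the characteristic
  functions cancels in the second difference of the energy, which therefore is a weighted squared
  \<open>L\<^sup>2\<close> distance of characteristic functions (\<open>powr_energy_char_diff\<close>).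

  So the excess energy of a centred measure \<open>\<eta>\<close> over Frank's measure is such a distance plus a
  linear term, the difference of the means of Frank's potential \<open>U\<close> under the two measures.  The
  linear term is nonnegative by the Euler-Lagrange conditions: the second derivative of \<open>U\<close> is
  \<open>(\<alpha> - 1) P - 1\<close>, where \<open>P\<close> is the potential of Frank's measure for the kernel
  \<open>\<bar>z\<bar> powr (\<alpha> - 2)\<close>.  Frank's density is the equilibrium density of that kernel, so \<open>P\<close>
  is constant on the support (\<open>riesz_equilibrium_integral\<close>), and \<open>P\<close> is not smaller outside.
  Hence \<open>U\<close> is convex, and constant on the support.  The outcome is \<open>energy_gap\<close>: the
  excess energy controls the distance of the characteristic functions.  In particular Frank's
  measure is a minimizer.

  The same inequality is a stability estimate.  Translate each \<open>\<mu> m\<close> to have mean zero.  Its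
  energy for the exponent \<open>\<beta> m\<close> is at most that of Frank's measure, and replacing
  \<open>\<beta> m\<close> by \<open>2\<close> costs at most a constant times \<open>\<bar>\<beta> m - 2\<bar>\<close>, because low energy bounds the
  moments.  Thus the weighted distances of the characteristic functions tend to zero.  These
  functions are equi-Lipschitz, hence converge pointwise, and Levy's continuity theorem gives weak
  convergence.  The whole sequence of translates converges, and with it every subsequence.
\<close>

section \<open>The equilibrium density of a Riesz kernel on an interval\<close>

lemma Beta_reflection:
  fixes a :: real
  assumes "0 < a" "a < 1"
  shows "Beta a (1 - a) = pi / sin (pi * a)"
proof -
  have "complex_of_real (Gamma a * Gamma (1 - a)) = complex_of_real (pi / sin (pi * a))"
    using Gamma_reflection_complex[of "complex_of_real a"] assms
    by (simp add: Gamma_complex_of_real[symmetric] sin_of_real[symmetric])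
  thus ?thesis by (simp only: of_real_eq_iff Beta_def) simp
qed

lemma nn_integral_Beta:
  fixes a b :: real
  assumes "0 < a" "0 < b"
  shows "(\<integral>\<^sup>+t. ennreal (t powr (a - 1) * (1 - t) powr (b - 1)) * indicator {0..1} t \<partial>lborel)
    = ennreal (Beta a b)"
  by (rule nn_integral_has_integral_lebesgue'[OF _ has_integral_Beta_real[OF assms]]) auto

text \<open>Folding a symmetric interval at the origin is how the odd part of an integrand is discarded below.\<close>

lemma nn_integral_symmetric_interval:
  fixes f :: "real \<Rightarrow> ennreal"
  assumes [measurable]: "f \<in> borel_measurable borel"
  shows "(\<integral>\<^sup>+t. f t * indicator {-c..c} t \<partial>lborel)
    = (\<integral>\<^sup>+t. (f t + f (- t)) * indicator {0..c} t \<partial>lborel)"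
proof -
  have "(\<integral>\<^sup>+t. f t * indicator {-c..c} t \<partial>lborel)
      = (\<integral>\<^sup>+t. f t * indicator {0..c} t + f t * indicator {-c..0} t \<partial>lborel)"
    by (intro nn_integral_cong_AE AE_I[of _ _ "{0}"]) (auto simp: indicator_def)
  also have "\<dots> = (\<integral>\<^sup>+t. f t * indicator {0..c} t \<partial>lborel) + (\<integral>\<^sup>+t. f t * indicator {-c..0} t \<partial>lborel)"
    by (rule nn_integral_add) auto
  also have "(\<integral>\<^sup>+t. f t * indicator {-c..0} t \<partial>lborel) = (\<integral>\<^sup>+t. f (- t) * indicator {0..c} t \<partial>lborel)"
    by (subst nn_integral_real_affine[of _ "-1" 0])
       (auto simp: indicator_def intro!: nn_integral_cong)
  also have "(\<integral>\<^sup>+t. f t * indicator {0..c} t \<partial>lborel) + \<dots>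
      = (\<integral>\<^sup>+t. (f t + f (- t)) * indicator {0..c} t \<partial>lborel)"
    by (subst nn_integral_add[symmetric]) (auto simp: algebra_simps)
  finally show ?thesis .
qed

lemma one_plus_mult_pos:
  fixes x t :: real
  assumes "\<bar>x\<bar> < 1" "t \<in> {-1..1}"
  shows "0 < 1 + x * t"
proof -
  have "\<bar>x\<bar> * \<bar>t\<bar> \<le> \<bar>x\<bar> * 1"
    using assms(2) by (intro mult_left_mono) auto
  hence "\<bar>x * t\<bar> < 1" using assms(1) by (simp add: abs_mult)
  thus ?thesis by linarith
qed

text \<open>The map \<open>t \<mapsto> R (t + x) / (1 + x t)\<close> is an automorphism of the interval that moves the
singularity of the kernel from \<open>t = 0\<close> to the point \<open>R x\<close>.  Each factor of the integrand is
multiplied by a power of \<open>1 + x t\<close>, and the exponent of the density is the one for which all but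
one of these powers cancel.\<close>

lemma riesz_moebius_integrand:
  fixes R x s t :: real
  assumes "0 < R" "\<bar>x\<bar> < 1" "t \<in> {-1..1}"
  defines "g \<equiv> R * (t + x) / (1 + x * t)"
  shows "\<bar>R * x - g\<bar> powr s * (R\<^sup>2 - g\<^sup>2) powr (- (1 + s) / 2) * (R * (1 - x\<^sup>2) / (1 + x * t)\<^sup>2)
    = (1 - x\<^sup>2) powr ((1 + s) / 2) * (\<bar>t\<bar> powr s * (1 - t\<^sup>2) powr (- (1 + s) / 2) / (1 + x * t))"
proof -
  define A where "A = 1 - x\<^sup>2"
  define D where "D = 1 + x * t"
  have A: "A > 0" unfolding A_def using assms(2) by (simp add: abs_square_less_1)
  have D: "D > 0" unfolding D_def by (rule one_plus_mult_pos) fact+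
  have t: "1 - t\<^sup>2 \<ge> 0" using assms(3) by (auto simp: abs_square_le_1)
  have 1: "\<bar>R * x - g\<bar> = R * \<bar>t\<bar> * A / D"
  proof -
    have "R * x - g = - (R * t * A / D)"
      unfolding g_def A_def D_def[symmetric] using D
      by (simp add: field_simps) (simp add: D_def power2_eq_square algebra_simps)
    thus ?thesis using A D assms(1) by (simp add: abs_mult)
  qed
  have 2: "R\<^sup>2 - g\<^sup>2 = R\<^sup>2 * (1 - t\<^sup>2) * A / D\<^sup>2"
    unfolding g_def D_def[symmetric] using D
    by (simp add: field_simps) (simp add: A_def D_def power2_eq_square algebra_simps)
  define e where "e = - (1 + s) / 2"
  have sq: "(z\<^sup>2) powr e = z powr (- (1 + s))" if "z > 0" for z :: real
  proof -
    have "(z\<^sup>2) powr e = z powr (2 * e)" using that by (simp add: powr_powr[symmetric])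
    also have "2 * e = - (1 + s)" by (simp add: e_def)
    finally show ?thesis .
  qed
  have R: "R powr s * R powr (- (1 + s)) * R = 1"
    using assms(1) by (simp add: powr_add[symmetric] powr_minus)
  have A': "A powr s * A powr e * A = A powr ((1 + s) / 2)"
  proof -
    have "A powr s * A powr e * A = A powr (s + e + 1)"
      using A by (simp add: powr_add)
    thus ?thesis by (simp add: e_def field_simps)
  qed
  have D': "D powr s * D powr (- (1 + s)) * D\<^sup>2 = D"
    using D by (simp add: powr_add[symmetric] powr_minus power2_eq_square)
  have "\<bar>R * x - g\<bar> powr s * (R\<^sup>2 - g\<^sup>2) powr e * (R * A / D\<^sup>2)
      = (R powr s * R powr (- (1 + s)) * R) * (A powr s * A powr e * A)
        * (\<bar>t\<bar> powr s * (1 - t\<^sup>2) powr e) / (D powr s * D powr (- (1 + s)) * D\<^sup>2)"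
    unfolding 1 2 using A D t assms(1) by (simp add: powr_mult powr_divide sq)
  thus ?thesis unfolding R A' D' by (simp add: A_def D_def e_def)
qed

text \<open>Symmetrising \<open>1 / (1 + x t)\<close> in \<open>t\<close> produces \<open>1 / (1 - x\<^sup>2 t\<^sup>2)\<close>.  With
\<open>u = t\<^sup>2\<close>, the new variable \<open>v\<close> satisfies \<open>v / (1 - v) = (1 - x\<^sup>2) u / (1 - u)\<close>; in
these odds coordinates the dependence on \<open>x\<close> is a mere dilation, and what remains is the
integrand of a Beta integral.\<close>

lemma riesz_Beta_integrand:
  fixes x s t :: real
  assumes "\<bar>x\<bar> < 1" "t \<in> {0<..<1}"
  defines "v \<equiv> (1 - x\<^sup>2) * t\<^sup>2 / (1 - x\<^sup>2 * t\<^sup>2)"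
  shows "v powr ((s - 1) / 2) * (1 - v) powr (- (1 + s) / 2) * (2 * t * (1 - x\<^sup>2) / (1 - x\<^sup>2 * t\<^sup>2)\<^sup>2)
    = 2 * (1 - x\<^sup>2) powr ((1 + s) / 2) * (t powr s * (1 - t\<^sup>2) powr (- (1 + s) / 2) / (1 - x\<^sup>2 * t\<^sup>2))"
proof -
  define A where "A = 1 - x\<^sup>2"
  define D where "D = 1 - x\<^sup>2 * t\<^sup>2"
  define e where "e = - (1 + s) / 2"
  define d where "d = (s - 1) / 2"
  have A: "A > 0" unfolding A_def using assms(1) by (simp add: abs_square_less_1)
  have "t\<^sup>2 < 1" using assms(2) by (simp add: abs_square_less_1)
  hence "x\<^sup>2 * t\<^sup>2 < 1"
    using assms(1) mult_mono[of "x\<^sup>2" 1 "t\<^sup>2" "t\<^sup>2"] abs_square_less_1[of x] by auto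
  hence D: "D > 0" unfolding D_def by auto
  have t: "1 - t\<^sup>2 > 0" "t > 0" using assms(2) \<open>t\<^sup>2 < 1\<close> by auto
  have 1: "v = A * t\<^sup>2 / D" by (simp add: v_def A_def D_def)
  have 2: "1 - v = (1 - t\<^sup>2) / D"
    unfolding 1 using D by (simp add: field_simps) (simp add: A_def D_def algebra_simps)
  have t': "(t\<^sup>2) powr d * t = t powr s"
  proof -
    have "(t\<^sup>2) powr d * t = t powr (2 * d + 1)"
      using t by (simp add: powr_powr powr_add flip: powr_numeral)
    also have "2 * d + 1 = s" by (simp add: d_def field_simps)
    finally show ?thesis .
  qed
  have A': "A powr d * A = A powr ((1 + s) / 2)"
  proof -
    have "A powr d * A = A powr (d + 1)" using A by (simp add: powr_add)
    thus ?thesis by (simp add: d_def field_simps)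
  qed
  have D': "D powr d * D powr e * D\<^sup>2 = D"
  proof -
    have "D powr d * D powr e = D powr (- 1)"
      by (subst powr_add[symmetric]) (simp add: d_def e_def field_simps)
    thus ?thesis using D by (simp add: powr_minus power2_eq_square)
  qed
  have "v powr d * (1 - v) powr e * (2 * t * A / D\<^sup>2)
     = 2 * (A powr d * A) * ((t\<^sup>2) powr d * t * (1 - t\<^sup>2) powr e) / (D powr d * D powr e * D\<^sup>2)"
    unfolding 2 unfolding 1 using A D t by (simp add: powr_mult powr_divide)
  thus ?thesis unfolding t' A' D' by (simp add: A_def D_def d_def e_def)
qed

text \<open>The potential of the density \<open>(R\<^sup>2 - y\<^sup>2) powr (- (1 + s) / 2)\<close> for the kernel
\<open>\<bar>z\<bar> powr s\<close> is constant inside the interval.  A Moebius map brings the evaluation point to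
the origin, folding removes the odd part, and the substitution to the Beta integral absorbs the
last factor depending on \<open>x\<close>.  The remaining \<open>Beta ((1 + s) / 2) ((1 - s) / 2)\<close> is evaluated by
the reflection formula.\<close>

lemma riesz_equilibrium_integral:
  fixes R x s :: real
  assumes R: "0 < R" and x: "\<bar>x\<bar> < 1" and s: "0 < s" "s < 1"
  shows "(\<integral>\<^sup>+y. ennreal (\<bar>R * x - y\<bar> powr s * (R\<^sup>2 - y\<^sup>2) powr (- (1 + s) / 2)) * indicator {-R..R} y \<partial>lborel)
    = ennreal (pi / cos (pi * s / 2))"
proof -
  define g where "g = (\<lambda>t. R * (t + x) / (1 + x * t))"
  define h where "h = (\<lambda>t. \<bar>t\<bar> powr s * (1 - t\<^sup>2) powr (- (1 + s) / 2))"
  define K where "K = (1 - x\<^sup>2) powr ((1 + s) / 2)"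
  have x2: "0 < 1 - x\<^sup>2" using x by (simp add: abs_square_less_1)
  have pos: "1 + x * t > 0" if "t \<in> {-1..1}" for t
    by (rule one_plus_mult_pos) fact+
  have pos2: "1 - x\<^sup>2 * t\<^sup>2 > 0" if "t \<in> {-1..1}" for t
  proof -
    have "(1 + x * t) * (1 + x * (- t)) > 0"
      using pos[of t] pos[of "-t"] that by (intro mult_pos_pos) auto
    thus ?thesis by (simp add: algebra_simps power2_eq_square)
  qed
  have ends: "g (-1) = -R" "g 1 = R"
    using x by (auto simp: g_def field_simps)
  have [measurable]: "h \<in> borel_measurable borel" unfolding h_def by measurable
  have "(\<integral>\<^sup>+y. ennreal (\<bar>R * x - y\<bar> powr s * (R\<^sup>2 - y\<^sup>2) powr (- (1 + s) / 2)) * indicator {-R..R} y \<partial>lborel)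
      = (\<integral>\<^sup>+y. ennreal (\<bar>R * x - y\<bar> powr s * (R\<^sup>2 - y\<^sup>2) powr (- (1 + s) / 2) * indicator {g (-1)..g 1} y) \<partial>lborel)"
    unfolding ends by (rule nn_integral_set_ennreal)
  also have "\<dots> = (\<integral>\<^sup>+t. ennreal (\<bar>R * x - g t\<bar> powr s * (R\<^sup>2 - (g t)\<^sup>2) powr (- (1 + s) / 2)
        * (R * (1 - x\<^sup>2) / (1 + x * t)\<^sup>2) * indicator {-1..1} t) \<partial>lborel)"
  proof (rule nn_integral_substitution)
    fix t :: real assume t: "t \<in> {-1..1}"
    show "(g has_real_derivative R * (1 - x\<^sup>2) / (1 + x * t)\<^sup>2) (at t)"
      unfolding g_def using pos[OF t]
      by (auto intro!: derivative_eq_intros simp: field_simps power2_eq_square)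
    show "R * (1 - x\<^sup>2) / (1 + x * t)\<^sup>2 \<ge> 0" using R x2 by auto
  next
    show "continuous_on {-1..1} (\<lambda>t. R * (1 - x\<^sup>2) / (1 + x * t)\<^sup>2)"
      using pos by (force intro!: continuous_intros)
  qed (auto simp: set_borel_measurable_def)
  also have "\<dots> = (\<integral>\<^sup>+t. ennreal (K * (h t / (1 + x * t))) * indicator {-1..1} t \<partial>lborel)"
  proof (intro nn_integral_cong)
    fix t :: real
    show "ennreal (\<bar>R * x - g t\<bar> powr s * (R\<^sup>2 - (g t)\<^sup>2) powr (- (1 + s) / 2)
        * (R * (1 - x\<^sup>2) / (1 + x * t)\<^sup>2) * indicator {-1..1} t)
      = ennreal (K * (h t / (1 + x * t))) * indicator {-1..1} t"
    proof (cases "t \<in> {-1..1}")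
      case True
      thus ?thesis
        by (simp only: g_def K_def h_def riesz_moebius_integrand[OF R x] indicator_simps mult_1_right)
    qed simp
  qed
  also have "\<dots> = (\<integral>\<^sup>+t. (ennreal (K * (h t / (1 + x * t))) + ennreal (K * (h (-t) / (1 + x * (-t)))))
      * indicator {0..1} t \<partial>lborel)"
    by (rule nn_integral_symmetric_interval) auto
  also have "\<dots> = (\<integral>\<^sup>+t. ennreal (2 * K * (h t / (1 - x\<^sup>2 * t\<^sup>2))) * indicator {0..1} t \<partial>lborel)"
  proof (intro nn_integral_cong, simp split: split_indicator, intro impI)
    fix t :: real assume t: "0 \<le> t \<and> t \<le> 1"
    hence p: "1 + x * t > 0" "1 - x * t > 0" using pos[of t] pos[of "-t"] by auto
    have q: "(1 + x * t) * (1 - x * t) = 1 - x\<^sup>2 * t\<^sup>2" by (simp add: algebra_simps power2_eq_square)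
    have "h t / (1 + x * t) + h t / (1 - x * t) = h t * 2 / ((1 + x * t) * (1 - x * t))"
      using p by (simp add: field_simps)
    hence "K * h t / (1 + x * t) + K * h t / (1 - x * t) = 2 * K * h t / (1 - x\<^sup>2 * t\<^sup>2)"
      unfolding q by (metis (no_types, lifting) distrib_left mult.assoc mult.commute times_divide_eq_right)
    moreover have "h (-t) = h t" by (simp add: h_def)
    moreover have "K \<ge> 0" "h t \<ge> 0" by (auto simp: K_def h_def)
    ultimately show "ennreal (K * h t / (1 + x * t)) + ennreal (K * h (-t) / (1 - x * t))
        = ennreal (2 * K * h t / (1 - x\<^sup>2 * t\<^sup>2))"
      using p by (simp flip: ennreal_plus)
  qed
  also have "\<dots> = (\<integral>\<^sup>+t. ennreal (((1 - x\<^sup>2) * t\<^sup>2 / (1 - x\<^sup>2 * t\<^sup>2)) powr ((s - 1) / 2)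
        * (1 - (1 - x\<^sup>2) * t\<^sup>2 / (1 - x\<^sup>2 * t\<^sup>2)) powr (- (1 + s) / 2)
        * (2 * t * (1 - x\<^sup>2) / (1 - x\<^sup>2 * t\<^sup>2)\<^sup>2) * indicator {0..1} t) \<partial>lborel)"
    (is "_ = ?I")
  proof (intro nn_integral_cong_AE AE_I[of _ _ "{0, 1}"] subsetI, rule ccontr)
    fix t assume t: "t \<in> {t \<in> space lborel. ennreal (2 * K * (h t / (1 - x\<^sup>2 * t\<^sup>2))) * indicator {0..1} t \<noteq>
        ennreal (((1 - x\<^sup>2) * t\<^sup>2 / (1 - x\<^sup>2 * t\<^sup>2)) powr ((s - 1) / 2)
        * (1 - (1 - x\<^sup>2) * t\<^sup>2 / (1 - x\<^sup>2 * t\<^sup>2)) powr (- (1 + s) / 2)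
        * (2 * t * (1 - x\<^sup>2) / (1 - x\<^sup>2 * t\<^sup>2)\<^sup>2) * indicator {0..1} t)}" "t \<notin> {0, 1}"
    show False
    proof (cases "t \<in> {0..1}")
      case True
      with t(2) have t': "t \<in> {0<..<1}" by auto
      hence "h t = t powr s * (1 - t\<^sup>2) powr (- (1 + s) / 2)" by (simp add: h_def)
      with t(1) True show False
        by (simp only: K_def riesz_Beta_integrand[OF x t'] indicator_simps mult_1_right mem_Collect_eq) blast
    qed (use t in simp)
  qed (auto simp: emeasure_lborel_countable)
  also have "?I = (\<integral>\<^sup>+v. ennreal (v powr ((s - 1) / 2) * (1 - v) powr (- (1 + s) / 2)
        * indicator {(1 - x\<^sup>2) * 0\<^sup>2 / (1 - x\<^sup>2 * 0\<^sup>2)..(1 - x\<^sup>2) * 1\<^sup>2 / (1 - x\<^sup>2 * 1\<^sup>2)} v) \<partial>lborel)"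
  proof (rule nn_integral_substitution[symmetric])
    fix t :: real assume t: "t \<in> {0..1}"
    hence p: "1 - x\<^sup>2 * t\<^sup>2 > 0" using pos2 by auto
    show "((\<lambda>t. (1 - x\<^sup>2) * t\<^sup>2 / (1 - x\<^sup>2 * t\<^sup>2)) has_real_derivative
        2 * t * (1 - x\<^sup>2) / (1 - x\<^sup>2 * t\<^sup>2)\<^sup>2) (at t)"
      using p
      apply (auto intro!: derivative_eq_intros)
      apply (simp add: field_simps power2_eq_square)
      done
    show "2 * t * (1 - x\<^sup>2) / (1 - x\<^sup>2 * t\<^sup>2)\<^sup>2 \<ge> 0" using t x2 by auto
  next
    have "1 - x\<^sup>2 * t\<^sup>2 \<noteq> 0" if "t \<in> {0..1}" for t using pos2[of t] that by auto
    thus "continuous_on {0..1} (\<lambda>t. 2 * t * (1 - x\<^sup>2) / (1 - x\<^sup>2 * t\<^sup>2)\<^sup>2)"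
      by (auto intro!: continuous_intros)
  qed (auto simp: set_borel_measurable_def)
  also have "\<dots> = (\<integral>\<^sup>+v. ennreal (v powr ((1 + s) / 2 - 1) * (1 - v) powr ((1 - s) / 2 - 1))
        * indicator {0..1} v \<partial>lborel)"
    using x2 by (intro nn_integral_cong) (auto simp: indicator_def field_simps)
  also have "\<dots> = ennreal (Beta ((1 + s) / 2) ((1 - s) / 2))"
    by (rule nn_integral_Beta) (use s in auto)
  also have "(1 - s) / 2 = 1 - (1 + s) / 2" by (simp add: field_simps)
  also have "Beta ((1 + s) / 2) (1 - (1 + s) / 2) = pi / sin (pi * ((1 + s) / 2))"
    by (rule Beta_reflection) (use s in auto)
  also have "pi * ((1 + s) / 2) = pi * s / 2 + pi / 2" by (simp add: field_simps)
  also have "sin (pi * s / 2 + pi / 2) = cos (pi * s / 2)" by (simp add: sin_add)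
  finally show ?thesis .
qed

lemma ultraspherical_mass:
  fixes R s :: real
  assumes R: "0 < R" and s: "0 < s" "s < 1"
  shows "(\<integral>\<^sup>+y. ennreal ((R\<^sup>2 - y\<^sup>2) powr (- (1 + s) / 2)) * indicator {-R..R} y \<partial>lborel)
    = ennreal (R powr (- s) * Beta (1 / 2) ((1 - s) / 2))"
proof -
  define B where "B = Beta (1 / 2) ((1 - s) / 2)"
  define e where "e = - (1 + s) / 2"
  have "(\<integral>\<^sup>+y. ennreal ((R\<^sup>2 - y\<^sup>2) powr e) * indicator {-R..R} y \<partial>lborel)
     = (\<integral>\<^sup>+y. (ennreal ((R\<^sup>2 - y\<^sup>2) powr e) + ennreal ((R\<^sup>2 - (-y)\<^sup>2) powr e)) * indicator {0..R} y \<partial>lborel)"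
    by (rule nn_integral_symmetric_interval) auto
  also have "\<dots> = (\<integral>\<^sup>+y. ennreal (R powr (- s)) * (ennreal ((y\<^sup>2 / R\<^sup>2) powr (- 1 / 2) * (1 - y\<^sup>2 / R\<^sup>2) powr e * (2 * y / R\<^sup>2)
        * indicator {0..R} y)) \<partial>lborel)"
  proof (intro nn_integral_cong_AE AE_I[of _ _ "{0}"])
    have "ennreal ((R\<^sup>2 - y\<^sup>2) powr e) + ennreal ((R\<^sup>2 - y\<^sup>2) powr e)
      = ennreal (R powr (- s)) * ennreal ((y\<^sup>2 / R\<^sup>2) powr (- 1 / 2) * (1 - y\<^sup>2 / R\<^sup>2) powr e * (2 * y / R\<^sup>2))"
      if y: "0 < y" "y \<le> R" for y
    proof -
      have "y\<^sup>2 \<le> R\<^sup>2" using y by (intro power_mono) auto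
      hence p: "1 - y\<^sup>2 / R\<^sup>2 \<ge> 0" using R by (simp add: field_simps)
      have 1: "R\<^sup>2 - y\<^sup>2 = R\<^sup>2 * (1 - y\<^sup>2 / R\<^sup>2)" using R by (simp add: field_simps)
      have sq: "(R\<^sup>2) powr e = R powr (- (1 + s))"
      proof -
        have "(R\<^sup>2) powr e = R powr (2 * e)" using R by (simp add: powr_powr[symmetric])
        also have "2 * e = - (1 + s)" by (simp add: e_def)
        finally show ?thesis .
      qed
      have "(y\<^sup>2 / R\<^sup>2) powr (- 1 / 2) = R / y"
        using R y by (simp add: powr_divide powr_minus powr_half_sqrt field_simps)
      moreover have "R powr (- (1 + s)) = R powr (- s) / R"
      proof -
        have "R powr (- s) = R powr (- (1 + s) + 1)" by simp
        also have "\<dots> = R powr (- (1 + s)) * R" using R by (simp only: powr_add powr_one)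
        finally show ?thesis using R by simp
      qed
      ultimately have "(R\<^sup>2 - y\<^sup>2) powr e + (R\<^sup>2 - y\<^sup>2) powr e =
         R powr (- s) * ((y\<^sup>2 / R\<^sup>2) powr (- 1 / 2) * (1 - y\<^sup>2 / R\<^sup>2) powr e * (2 * y / R\<^sup>2))"
        unfolding 1 using p R y by (simp add: powr_mult sq) (simp add: power2_eq_square)
      thus ?thesis
        using R y by (subst ennreal_plus[symmetric]) (auto simp flip: ennreal_mult)
    qed
    thus "{y \<in> space lborel. (ennreal ((R\<^sup>2 - y\<^sup>2) powr e) + ennreal ((R\<^sup>2 - (-y)\<^sup>2) powr e)) * indicator {0..R} y \<noteq>
        ennreal (R powr (- s)) * (ennreal ((y\<^sup>2 / R\<^sup>2) powr (- 1 / 2) * (1 - y\<^sup>2 / R\<^sup>2) powr e * (2 * y / R\<^sup>2)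
        * indicator {0..R} y))} \<subseteq> {0}"
      by (auto simp: indicator_def) (metis order_le_less)
  qed auto
  also have "\<dots> = ennreal (R powr (- s)) * (\<integral>\<^sup>+y. (ennreal ((y\<^sup>2 / R\<^sup>2) powr (- 1 / 2) * (1 - y\<^sup>2 / R\<^sup>2) powr e * (2 * y / R\<^sup>2)
        * indicator {0..R} y)) \<partial>lborel)"
    by (rule nn_integral_cmult) auto
  also have "(\<integral>\<^sup>+y. (ennreal ((y\<^sup>2 / R\<^sup>2) powr (- 1 / 2) * (1 - y\<^sup>2 / R\<^sup>2) powr e * (2 * y / R\<^sup>2)
        * indicator {0..R} y)) \<partial>lborel)
     = (\<integral>\<^sup>+v. ennreal (v powr (- 1 / 2) * (1 - v) powr e * indicator {0\<^sup>2 / R\<^sup>2..R\<^sup>2 / R\<^sup>2} v) \<partial>lborel)"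
    by (rule nn_integral_substitution[symmetric])
       (use R in \<open>auto intro!: derivative_eq_intros continuous_intros
         simp: set_borel_measurable_def divide_simps power2_eq_square power4_eq_xxxx\<close>)
  also have "\<dots> = (\<integral>\<^sup>+v. ennreal (v powr (1 / 2 - 1) * (1 - v) powr ((1 - s) / 2 - 1))
        * indicator {0..1} v \<partial>lborel)"
    using R by (intro nn_integral_cong) (auto simp: indicator_def field_simps e_def)
  also have "\<dots> = ennreal B"
    unfolding B_def by (rule nn_integral_Beta) (use s in auto)
  also have "ennreal (R powr (- s)) * ennreal B = ennreal (R powr (- s) * B)"
    by (rule ennreal_mult'[symmetric]) auto
  finally show ?thesis by (simp add: B_def e_def)
qed

section \<open>The potential of Frank's measure\<close>

lemma has_real_derivative_abs_powr:
  fixes a z :: real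
  assumes "1 < a"
  shows "((\<lambda>z. \<bar>z\<bar> powr a) has_real_derivative a * (sgn z * \<bar>z\<bar> powr (a - 1))) (at z)"
proof -
  consider "z > 0" | "z < 0" | "z = 0" by linarith
  thus ?thesis
  proof cases
    case 1
    have "((\<lambda>z. z powr a) has_real_derivative a * (sgn z * \<bar>z\<bar> powr (a - 1))) (at z)"
      using 1 by (auto intro!: derivative_eq_intros)
    thus ?thesis
      by (rule has_field_derivative_transform_within_open[of _ _ _ "{0<..}"]) (use 1 in auto)
  next
    case 2
    have "((\<lambda>z. (- z) powr a) has_real_derivative a * (sgn z * \<bar>z\<bar> powr (a - 1))) (at z)"
      using 2 by (auto intro!: derivative_eq_intros)
    thus ?thesis
      by (rule has_field_derivative_transform_within_open[of _ _ _ "{..<0}"]) (use 2 in auto)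
  next
    case 3
    have "((\<lambda>h. \<bar>h\<bar> powr (a - 1)) \<longlongrightarrow> 0) (at (0::real))"
      using assms by (auto intro!: tendsto_eq_intros)
    hence "((\<lambda>h. \<bar>h\<bar> powr a / h) \<longlongrightarrow> 0) (at (0::real))"
    proof (rule Lim_null_comparison[rotated])
      show "\<forall>\<^sub>F h::real in at 0. norm (\<bar>h\<bar> powr a / h) \<le> \<bar>h\<bar> powr (a - 1)"
        by (auto simp: eventually_at_filter powr_diff intro!: always_eventually)
    qed
    thus ?thesis using 3 by (simp add: has_field_derivative_iff)
  qed
qed

lemma has_real_derivative_sgn_abs_powr:
  fixes b z :: real
  assumes "1 < b"
  shows "((\<lambda>z. sgn z * \<bar>z\<bar> powr b) has_real_derivative b * \<bar>z\<bar> powr (b - 1)) (at z)"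
proof -
  consider "z > 0" | "z < 0" | "z = 0" by linarith
  thus ?thesis
  proof cases
    case 1
    have "((\<lambda>z. z powr b) has_real_derivative b * \<bar>z\<bar> powr (b - 1)) (at z)"
      using 1 by (auto intro!: derivative_eq_intros)
    thus ?thesis
      by (rule has_field_derivative_transform_within_open[of _ _ _ "{0<..}"]) (use 1 in auto)
  next
    case 2
    have "((\<lambda>z. - ((- z) powr b)) has_real_derivative b * \<bar>z\<bar> powr (b - 1)) (at z)"
      using 2 by (auto intro!: derivative_eq_intros)
    thus ?thesis
      by (rule has_field_derivative_transform_within_open[of _ _ _ "{..<0}"]) (use 2 in auto)
  next
    case 3
    have "((\<lambda>h. \<bar>h\<bar> powr (b - 1)) \<longlongrightarrow> 0) (at (0::real))"
      using assms by (auto intro!: tendsto_eq_intros)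
    hence "((\<lambda>h. sgn h * \<bar>h\<bar> powr b / h) \<longlongrightarrow> 0) (at (0::real))"
    proof (rule Lim_null_comparison[rotated])
      show "\<forall>\<^sub>F h::real in at 0. norm (sgn h * \<bar>h\<bar> powr b / h) \<le> \<bar>h\<bar> powr (b - 1)"
        by (auto simp: eventually_at_filter powr_diff abs_mult abs_sgn_eq intro!: always_eventually)
    qed
    thus ?thesis using 3 by (simp add: has_field_derivative_iff)
  qed
qed

lemma continuous_bounded_near:
  fixes f :: "real \<Rightarrow> real"
  assumes "continuous_on UNIV f"
  obtains C where "\<And>z. \<bar>x - z\<bar> \<le> r \<Longrightarrow> \<bar>f z\<bar> \<le> C"
proof -
  have "compact (f ` cball x r)"
    by (intro compact_continuous_image continuous_on_subset[OF assms]) auto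
  hence "bounded (f ` cball x r)" by (rule compact_imp_bounded)
  then obtain C where "\<forall>z\<in>cball x r. \<bar>f z\<bar> \<le> C"
    unfolding bounded_iff by auto
  thus ?thesis by (intro that[of C]) (auto simp: dist_real_def)
qed

lemma continuous_on_abs_powr:
  fixes a :: real
  assumes "0 < a" "continuous_on A f"
  shows "continuous_on A (\<lambda>z. \<bar>f z\<bar> powr a)"
  using assms by (intro continuous_on_powr' continuous_intros) auto

text \<open>On a compactly supported measure the difference quotients are dominated by the maximum of
\<open>\<bar>f'\<bar>\<close> on a compact interval.\<close>

lemma has_derivative_convolution:
  fixes f f' :: "real \<Rightarrow> real" and M :: "real measure"
  assumes "prob_space M"
    and sets[measurable_cong]: "sets M = sets borel"
    and supp: "AE y in M. \<bar>y\<bar> \<le> R"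
    and deriv: "\<And>z. (f has_real_derivative f' z) (at z)"
    and cont: "continuous_on UNIV f'"
  shows "((\<lambda>x. \<integral>y. f (x - y) \<partial>M) has_real_derivative (\<integral>y. f' (x - y) \<partial>M)) (at x)"
proof -
  interpret prob_space M by fact
  have contf: "continuous_on UNIV f"
    using deriv by (auto intro!: continuous_at_imp_continuous_on DERIV_isCont)
  have [measurable]: "f \<in> borel_measurable borel" "f' \<in> borel_measurable borel"
    using contf cont by (auto intro: borel_measurable_continuous_onI)
  have int: "integrable M (\<lambda>y. f (x - y))" for x
  proof -
    obtain C where C: "\<And>z. \<bar>x - z\<bar> \<le> R \<Longrightarrow> \<bar>f z\<bar> \<le> C"
      using continuous_bounded_near[OF contf, where x = x and r = R] by blast
    show ?thesis
      by (rule integrable_const_bound[where B = C])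
         (use supp in \<open>auto elim!: eventually_mono intro!: C simp: dist_real_def\<close>)
  qed
  show ?thesis
    unfolding DERIV_def tendsto_at_iff_sequentially
  proof (intro allI impI)
    fix h :: "nat \<Rightarrow> real" assume h: "\<forall>i. h i \<in> UNIV - {0}" "h \<longlonglongrightarrow> 0"
    from h(2) have "Bseq h" by (intro convergent_imp_Bseq convergentI)
    then obtain H where H: "\<And>n. \<bar>h n\<bar> \<le> H" by (metis BseqE real_norm_def)
    have H0: "0 \<le> H" using H[of 0] by linarith
    obtain C where C: "\<And>z. \<bar>x - z\<bar> \<le> R + H \<Longrightarrow> \<bar>f' z\<bar> \<le> C"
      using continuous_bounded_near[OF cont, where x = x and r = "R + H"] by blast
    have "(\<lambda>n. \<integral>y. (f (x + h n - y) - f (x - y)) / h n \<partial>M) \<longlonglongrightarrow> (\<integral>y. f' (x - y) \<partial>M)"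
    proof (rule integral_dominated_convergence[where w = "\<lambda>_. C"])
      show "AE y in M. (\<lambda>n. (f (x + h n - y) - f (x - y)) / h n) \<longlonglongrightarrow> f' (x - y)"
      proof (rule AE_I2)
        fix y
        have "((\<lambda>h. (f (x - y + h) - f (x - y)) / h) \<longlongrightarrow> f' (x - y)) (at 0)"
          using deriv[of "x - y"] by (simp add: DERIV_def)
        from this[unfolded tendsto_at_iff_sequentially, rule_format, of h] h
        show "(\<lambda>n. (f (x + h n - y) - f (x - y)) / h n) \<longlonglongrightarrow> f' (x - y)"
          by (simp add: o_def algebra_simps)
      qed
      fix n
      show "AE y in M. norm ((f (x + h n - y) - f (x - y)) / h n) \<le> C"
        using supp
      proof eventually_elim
        case (elim y)
        have "norm (f (x + h n - y) - f (x - y)) \<le> C * norm (x + h n - y - (x - y))"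
          by (rule field_differentiable_bound[of "cball x (R + H)", OF _ has_field_derivative_at_within[OF deriv]])
             (use elim H[of n] H0 in \<open>auto intro!: C simp: dist_real_def\<close>)
        thus ?case using h(1) by (simp add: field_simps)
      qed
    qed auto
    moreover have "(\<integral>y. (f (x + h n - y) - f (x - y)) / h n \<partial>M)
        = ((\<integral>y. f (x + h n - y) \<partial>M) - (\<integral>y. f (x - y) \<partial>M)) / h n" for n
      using int[of x] int[of "x + h n"] by simp
    ultimately show "((\<lambda>xa. ((\<integral>y. f (x + xa - y) \<partial>M) - (\<integral>y. f (x - y) \<partial>M)) / xa) \<circ> h)
        \<longlonglongrightarrow> (\<integral>y. f' (x - y) \<partial>M)"
      unfolding o_def by (simp only:)
  qed
qed

definition frank_measure :: "real \<Rightarrow> real measure" where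
  "frank_measure \<alpha> = density lborel (\<lambda>x. ennreal (frank_density \<alpha> x))"

lemma measurable_frank_density [measurable]: "frank_density \<alpha> \<in> borel_measurable borel"
  unfolding frank_density_def[abs_def] by measurable

lemma sets_frank_measure [simp, measurable_cong]: "sets (frank_measure \<alpha>) = sets borel"
  by (simp add: frank_measure_def)

lemma space_frank_measure [simp]: "space (frank_measure \<alpha>) = UNIV"
  by (simp add: frank_measure_def)

lemma frank_density_uminus [simp]: "frank_density \<alpha> (- x) = frank_density \<alpha> x"
  by (simp add: frank_density_def)

lemma distr_uminus_frank_measure: "distr (frank_measure \<alpha>) borel uminus = frank_measure \<alpha>"
proof (rule measure_eqI)
  fix A :: "real set" assume "A \<in> sets (distr (frank_measure \<alpha>) borel uminus)"
  hence [measurable]: "A \<in> sets borel" by simp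
  have "emeasure (distr (frank_measure \<alpha>) borel uminus) A
      = (\<integral>\<^sup>+x. ennreal (frank_density \<alpha> x) * indicator (uminus -` A) x \<partial>lborel)"
    by (subst emeasure_distr)
       (auto simp: frank_measure_def emeasure_density measurable_sets_borel[of uminus borel A])
  also have "\<dots> = (\<integral>\<^sup>+x. ennreal (frank_density \<alpha> x) * indicator A x \<partial>lborel)"
    by (subst nn_integral_real_affine[of _ "-1" 0])
       (auto simp: indicator_def intro!: nn_integral_cong)
  also have "\<dots> = emeasure (frank_measure \<alpha>) A"
    by (simp add: frank_measure_def emeasure_density)
  finally show "emeasure (distr (frank_measure \<alpha>) borel uminus) A = emeasure (frank_measure \<alpha>) A" .
qed simp

lemma integral_frank_uminus:
  fixes f :: "real \<Rightarrow> real"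
  assumes "f \<in> borel_measurable borel"
  shows "(\<integral>y. f (- y) \<partial>frank_measure \<alpha>) = (\<integral>y. f y \<partial>frank_measure \<alpha>)"
proof -
  have "(\<integral>y. f y \<partial>distr (frank_measure \<alpha>) borel uminus) = (\<integral>y. f (- y) \<partial>frank_measure \<alpha>)"
    by (rule integral_distr) (use assms in auto)
  thus ?thesis by (simp only: distr_uminus_frank_measure)
qed

text \<open>The potential for the kernel \<open>\<bar>z\<bar> powr (\<alpha> - 2)\<close>, which governs the second derivative of
\<open>frank_potential\<close>.\<close>

definition frank_riesz :: "real \<Rightarrow> real \<Rightarrow> real" where
  "frank_riesz \<alpha> x = (\<integral>y. \<bar>x - y\<bar> powr (\<alpha> - 2) \<partial>frank_measure \<alpha>)"

definition frank_potential :: "real \<Rightarrow> real \<Rightarrow> real" where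
  "frank_potential \<alpha> x = (\<integral>y. \<bar>x - y\<bar> powr \<alpha> / \<alpha> - (x - y)\<^sup>2 / 2 \<partial>frank_measure \<alpha>)"

context
  fixes \<alpha> :: real
  assumes \<alpha>: "2 < \<alpha>" "\<alpha> < 3"
begin

lemma frank_const_pos: "0 < frank_const \<alpha>"
proof -
  have "pi * (\<alpha> - 2) < pi * 1" using \<alpha> by (intro mult_strict_left_mono) auto
  hence "cos (pi * (\<alpha> - 2) / 2) > 0"
    using \<alpha> by (intro cos_gt_zero) auto
  thus ?thesis using \<alpha> by (auto simp: frank_const_def)
qed

lemma frank_Beta_pos: "0 < Beta (1 / 2) ((3 - \<alpha>) / 2)"
  unfolding Beta_def using \<alpha> by (intro divide_pos_pos mult_pos_pos Gamma_real_pos) (auto simp: field_simps)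

lemma frank_radius_pos: "0 < frank_radius \<alpha>"
  using frank_const_pos frank_Beta_pos by (simp add: frank_radius_def)

lemma frank_radius_mass:
  "frank_const \<alpha> * (frank_radius \<alpha> powr (- (\<alpha> - 2)) * Beta (1 / 2) ((3 - \<alpha>) / 2)) = 1"
proof -
  have "frank_radius \<alpha> powr (\<alpha> - 2) = frank_const \<alpha> * Beta (1 / 2) ((3 - \<alpha>) / 2)"
    using frank_const_pos frank_Beta_pos \<alpha> by (simp add: frank_radius_def powr_powr)
  hence "frank_radius \<alpha> powr (- (\<alpha> - 2)) = 1 / (frank_const \<alpha> * Beta (1 / 2) ((3 - \<alpha>) / 2))"
    by (simp only: powr_minus inverse_eq_divide)
  thus ?thesis using frank_const_pos frank_Beta_pos by simp
qed

lemma frank_density_closed: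
  "ennreal (frank_density \<alpha> x) = ennreal (frank_const \<alpha>)
    * (ennreal (((frank_radius \<alpha>)\<^sup>2 - x\<^sup>2) powr (- (1 + (\<alpha> - 2)) / 2))
    * indicator {- frank_radius \<alpha>..frank_radius \<alpha>} x)"
proof -
  have "x\<^sup>2 = (frank_radius \<alpha>)\<^sup>2" if "\<bar>x\<bar> = frank_radius \<alpha>"
    using that by (metis power2_abs)
  moreover have "\<bar>x\<bar> = frank_radius \<alpha>"
    if "\<not> \<bar>x\<bar> < frank_radius \<alpha>" "- frank_radius \<alpha> \<le> x" "x \<le> frank_radius \<alpha>"
    using that by linarith
  moreover have "- (1 + (\<alpha> - 2)) / 2 = (1 - \<alpha>) / 2" by (simp add: field_simps)
  ultimately show ?thesis using frank_const_pos
    by (auto simp: frank_density_def indicator_def ennreal_mult' abs_if split: if_splits)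
qed

lemma prob_space_frank_measure: "prob_space (frank_measure \<alpha>)"
proof
  have "emeasure (frank_measure \<alpha>) (space (frank_measure \<alpha>))
      = (\<integral>\<^sup>+x. ennreal (frank_density \<alpha> x) \<partial>lborel)"
    by (simp add: frank_measure_def emeasure_density)
  also have "\<dots> = ennreal (frank_const \<alpha>) * (\<integral>\<^sup>+x. ennreal (((frank_radius \<alpha>)\<^sup>2 - x\<^sup>2)
      powr (- (1 + (\<alpha> - 2)) / 2)) * indicator {- frank_radius \<alpha>..frank_radius \<alpha>} x \<partial>lborel)"
    unfolding frank_density_closed by (rule nn_integral_cmult) auto
  also have "\<dots> = ennreal (frank_const \<alpha>) * ennreal (frank_radius \<alpha> powr (- (\<alpha> - 2))
      * Beta (1 / 2) ((1 - (\<alpha> - 2)) / 2))"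
    by (subst ultraspherical_mass) (use frank_radius_pos \<alpha> in auto)
  also have "1 - (\<alpha> - 2) = 3 - \<alpha>" by simp
  also have "ennreal (frank_const \<alpha>) * ennreal (frank_radius \<alpha> powr (- (\<alpha> - 2))
      * Beta (1 / 2) ((3 - \<alpha>) / 2)) = 1"
    using frank_const_pos frank_radius_mass by (subst ennreal_mult'[symmetric]) auto
  finally show "emeasure (frank_measure \<alpha>) (space (frank_measure \<alpha>)) = 1" .
qed

interpretation F: prob_space "frank_measure \<alpha>" by (rule prob_space_frank_measure)

lemma AE_frank_measure: "AE y in frank_measure \<alpha>. \<bar>y\<bar> < frank_radius \<alpha>"
  unfolding frank_measure_def
  by (subst AE_density) (auto simp: frank_density_def)

lemma integrable_frank_measure:
  fixes f :: "real \<Rightarrow> real"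
  assumes "continuous_on UNIV f"
  shows "integrable (frank_measure \<alpha>) f"
proof -
  obtain C where C: "\<And>z. \<bar>0 - z\<bar> \<le> frank_radius \<alpha> \<Longrightarrow> \<bar>f z\<bar> \<le> C"
    using continuous_bounded_near[OF assms, where x = 0 and r = "frank_radius \<alpha>"] by blast
  have [measurable]: "f \<in> borel_measurable borel"
    using assms by (rule borel_measurable_continuous_onI)
  show ?thesis
    by (rule F.integrable_const_bound[where B = C])
       (use AE_frank_measure in \<open>auto elim!: eventually_mono intro!: C simp: dist_real_def\<close>)
qed

lemma integrable_frank_riesz: "integrable (frank_measure \<alpha>) (\<lambda>y. \<bar>x - y\<bar> powr (\<alpha> - 2))"
  using \<alpha> by (intro integrable_frank_measure continuous_on_abs_powr continuous_intros) auto

lemma frank_riesz_uminus: "frank_riesz \<alpha> (- x) = frank_riesz \<alpha> x"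
proof -
  have "frank_riesz \<alpha> (- x) = (\<integral>y. \<bar>x - (- y)\<bar> powr (\<alpha> - 2) \<partial>frank_measure \<alpha>)"
    unfolding frank_riesz_def by (intro Bochner_Integration.integral_cong refl arg_cong2[of _ _ _ _ "(powr)"]) linarith
  also have "\<dots> = frank_riesz \<alpha> x"
    unfolding frank_riesz_def
    by (rule integral_frank_uminus[of "\<lambda>y. \<bar>x - y\<bar> powr (\<alpha> - 2)"]) auto
  finally show ?thesis .
qed

lemma frank_riesz_inside:
  assumes "\<bar>x\<bar> < frank_radius \<alpha>"
  shows "(\<alpha> - 1) * frank_riesz \<alpha> x = 1"
proof -
  define R where "R = frank_radius \<alpha>"
  have R: "R > 0" unfolding R_def by (rule frank_radius_pos)
  define z where "z = x / R"
  have z: "\<bar>z\<bar> < 1" "x = R * z" using R assms by (auto simp: z_def R_def[symmetric])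
  have "ennreal (frank_riesz \<alpha> x) = (\<integral>\<^sup>+y. ennreal (\<bar>x - y\<bar> powr (\<alpha> - 2)) \<partial>frank_measure \<alpha>)"
    unfolding frank_riesz_def
    by (rule nn_integral_eq_integral[symmetric]) (auto intro: integrable_frank_riesz)
  also have "\<dots> = (\<integral>\<^sup>+y. ennreal (frank_density \<alpha> y) * ennreal (\<bar>x - y\<bar> powr (\<alpha> - 2)) \<partial>lborel)"
    unfolding frank_measure_def by (rule nn_integral_density) auto
  also have "\<dots> = (\<integral>\<^sup>+y. ennreal (frank_const \<alpha>) * (ennreal (\<bar>R * z - y\<bar> powr (\<alpha> - 2)
      * (R\<^sup>2 - y\<^sup>2) powr (- (1 + (\<alpha> - 2)) / 2)) * indicator {-R..R} y) \<partial>lborel)"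
    unfolding frank_density_closed R_def[symmetric] z(2)
    by (intro nn_integral_cong) (simp add: ennreal_mult' mult_ac)
  also have "\<dots> = ennreal (frank_const \<alpha>) * ennreal (pi / cos (pi * (\<alpha> - 2) / 2))"
  proof (subst nn_integral_cmult)
    have "0 < \<alpha> - 2" "\<alpha> - 2 < 1" using \<alpha> by auto
    from riesz_equilibrium_integral[OF R z(1) this]
    show "ennreal (frank_const \<alpha>) * (\<integral>\<^sup>+y. ennreal (\<bar>R * z - y\<bar> powr (\<alpha> - 2)
        * (R\<^sup>2 - y\<^sup>2) powr (- (1 + (\<alpha> - 2)) / 2)) * indicator {-R..R} y \<partial>lborel)
      = ennreal (frank_const \<alpha>) * ennreal (pi / cos (pi * (\<alpha> - 2) / 2))"
      by (simp only:)
  qed auto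
  also have "\<dots> = ennreal (1 / (\<alpha> - 1))"
    using frank_const_pos
    by (subst ennreal_mult'[symmetric]) (auto simp: frank_const_def)
  finally have "frank_riesz \<alpha> x = 1 / (\<alpha> - 1)"
    using \<alpha> by (subst (asm) ennreal_inj) (auto simp: frank_riesz_def)
  thus ?thesis using \<alpha> by simp
qed

text \<open>Moving from a point near the right end of the support to a point beyond it increases the distance
to all of the support except a short piece, where the kernel is small anyway; so the value cannot
drop below the constant value inside.  The left side follows by symmetry.\<close>

lemma frank_riesz_ge: "(\<alpha> - 1) * frank_riesz \<alpha> x \<ge> 1"
proof -
  define R where "R = frank_radius \<alpha>"
  define s where "s = \<alpha> - 2"
  have R: "R > 0" unfolding R_def by (rule frank_radius_pos)
  have s: "s > 0" using \<alpha> by (simp add: s_def)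
  have right: "(\<alpha> - 1) * frank_riesz \<alpha> x \<ge> 1" if x: "x \<ge> R" for x
  proof -
    have "1 / (\<alpha> - 1) \<le> frank_riesz \<alpha> x"
    proof (rule field_le_epsilon)
      fix d :: real assume d: "d > 0"
      \<comment> \<open>chosen so that the short piece of the support beyond \<open>R - e\<close> contributes at most \<open>d\<close>\<close>
      define e where "e = min (R / 2) (d powr (1 / s))"
      have e: "0 < e" "e \<le> R / 2" "e powr s \<le> d"
      proof -
        show "0 < e" "e \<le> R / 2" using R d by (auto simp: e_def)
        have "e powr s \<le> (d powr (1 / s)) powr s"
          using s \<open>0 < e\<close> by (intro powr_mono2) (auto simp: e_def)
        thus "e powr s \<le> d" using s d by (simp add: powr_powr)
      qed
      have "frank_riesz \<alpha> (R - e) \<le> (\<integral>y. \<bar>x - y\<bar> powr s + e powr s \<partial>frank_measure \<alpha>)"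
        unfolding frank_riesz_def s_def[symmetric]
      proof (rule integral_mono_AE)
        show "AE y in frank_measure \<alpha>. \<bar>R - e - y\<bar> powr s \<le> \<bar>x - y\<bar> powr s + e powr s"
          using AE_frank_measure
        proof eventually_elim
          case (elim y)
          hence y: "\<bar>y\<bar> < R" by (simp add: R_def)
          show ?case
          proof (cases "y \<le> R - e")
            case True
            hence "\<bar>R - e - y\<bar> powr s \<le> \<bar>x - y\<bar> powr s"
              using s x e by (intro powr_mono2) auto
            thus ?thesis by (simp add: add_increasing2)
          next
            case False
            hence "\<bar>R - e - y\<bar> powr s \<le> e powr s"
              using s e y by (intro powr_mono2) auto
            thus ?thesis by (simp add: add_increasing)
          qed
        qed
      qed (use integrable_frank_riesz in \<open>auto simp: s_def\<close>)
      also have "\<dots> = frank_riesz \<alpha> x + e powr s"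
        using integrable_frank_riesz[of x] F.prob_space
        by (simp add: frank_riesz_def s_def)
      finally have "frank_riesz \<alpha> (R - e) \<le> frank_riesz \<alpha> x + d" using e by linarith
      moreover have "(\<alpha> - 1) * frank_riesz \<alpha> (R - e) = 1"
        by (rule frank_riesz_inside) (use e R in \<open>auto simp: R_def\<close>)
      hence "frank_riesz \<alpha> (R - e) = 1 / (\<alpha> - 1)" using \<alpha> by (simp add: eq_divide_eq mult.commute)
      ultimately show "1 / (\<alpha> - 1) \<le> frank_riesz \<alpha> x + d" by simp
    qed
    thus ?thesis using \<alpha> by (simp add: field_simps)
  qed
  show ?thesis
    using right[of x] right[of "-x"] frank_riesz_inside[of x]
    by (cases "\<bar>x\<bar> < R") (auto simp: frank_riesz_uminus abs_if R_def split: if_splits)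
qed

text \<open>Differentiating twice under the integral turns the interaction kernel into
\<open>(\<alpha> - 1) \<bar>z\<bar> powr (\<alpha> - 2) - 1\<close>; the first derivative vanishes at the origin because the
measure is symmetric.\<close>

lemma frank_potential_derivatives:
  obtains U' where
    "\<And>x. (frank_potential \<alpha> has_real_derivative U' x) (at x)"
    "\<And>x. (U' has_real_derivative (\<alpha> - 1) * frank_riesz \<alpha> x - 1) (at x)"
    "U' 0 = 0"
proof -
  define f0 where "f0 = (\<lambda>z::real. \<bar>z\<bar> powr \<alpha> / \<alpha> - z\<^sup>2 / 2)"
  define f1 where "f1 = (\<lambda>z::real. sgn z * \<bar>z\<bar> powr (\<alpha> - 1) - z)"
  define f2 where "f2 = (\<lambda>z::real. (\<alpha> - 1) * \<bar>z\<bar> powr (\<alpha> - 2) - 1)"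
  have d0: "(f0 has_real_derivative f1 z) (at z)" for z
  proof -
    have "((\<lambda>z. z\<^sup>2 / 2) has_real_derivative z) (at z)" by (auto intro!: derivative_eq_intros)
    from DERIV_diff[OF DERIV_cdivide[OF has_real_derivative_abs_powr[of \<alpha> z], of \<alpha>] this]
    show ?thesis using \<alpha> by (simp add: f0_def f1_def)
  qed
  have d1: "(f1 has_real_derivative f2 z) (at z)" for z
    unfolding f1_def f2_def
    using DERIV_diff[OF has_real_derivative_sgn_abs_powr[of "\<alpha> - 1" z] DERIV_ident] \<alpha> by simp
  have c1: "continuous_on UNIV f1"
    using d1 by (auto intro!: continuous_at_imp_continuous_on DERIV_isCont)
  have c2: "continuous_on UNIV f2"
    unfolding f2_def using \<alpha> by (intro continuous_intros continuous_on_abs_powr) auto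
  have supp: "AE y in frank_measure \<alpha>. \<bar>y\<bar> \<le> frank_radius \<alpha>"
    using AE_frank_measure by eventually_elim simp
  define U' where "U' x = (\<integral>y. f1 (x - y) \<partial>frank_measure \<alpha>)" for x
  show ?thesis
  proof (rule that[of U'])
    fix x
    show "(frank_potential \<alpha> has_real_derivative U' x) (at x)"
      using has_derivative_convolution[OF prob_space_frank_measure _ supp d0 c1, of x]
      by (simp add: frank_potential_def[abs_def] U'_def f0_def)
    have "(\<integral>y. f2 (x - y) \<partial>frank_measure \<alpha>) = (\<alpha> - 1) * frank_riesz \<alpha> x - 1"
      using integrable_frank_riesz[of x] F.prob_space by (simp add: f2_def frank_riesz_def)
    thus "(U' has_real_derivative (\<alpha> - 1) * frank_riesz \<alpha> x - 1) (at x)"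
      using has_derivative_convolution[OF prob_space_frank_measure _ supp d1 c2, of x]
      by (simp add: U'_def[abs_def])
  next
    have [measurable]: "f1 \<in> borel_measurable borel"
      using c1 by (rule borel_measurable_continuous_onI)
    have "(\<integral>y. f1 (- y) \<partial>frank_measure \<alpha>) = (\<integral>y. - f1 (- y) \<partial>frank_measure \<alpha>)"
      by (subst integral_frank_uminus) (auto simp: f1_def intro!: Bochner_Integration.integral_cong)
    thus "U' 0 = 0" by (simp add: U'_def)
  qed
qed

text \<open>Together with \<open>frank_potential_eq\<close> this is the Euler-Lagrange condition.  The potential is
convex with a critical point at the origin.\<close>

lemma frank_potential_ge: "frank_potential \<alpha> 0 \<le> frank_potential \<alpha> x"
proof -
  from frank_potential_derivatives obtain U' where U:
    "\<And>x. (frank_potential \<alpha> has_real_derivative U' x) (at x)"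
    "\<And>x. (U' has_real_derivative (\<alpha> - 1) * frank_riesz \<alpha> x - 1) (at x)" "U' 0 = 0"
    by blast
  have mono: "U' x \<le> U' y" if "x \<le> y" for x y
    using that
  proof (rule DERIV_nonneg_imp_nondecreasing)
    fix z show "\<exists>d. DERIV U' z :> d \<and> 0 \<le> d"
      using U(2)[of z] frank_riesz_ge[of z] by (intro exI[of _ "(\<alpha> - 1) * frank_riesz \<alpha> z - 1"]) simp
  qed
  show ?thesis
  proof (cases "x \<ge> 0")
    case True
    thus ?thesis
    proof (rule DERIV_nonneg_imp_nondecreasing)
      fix z :: real assume "0 \<le> z"
      thus "\<exists>d. DERIV (frank_potential \<alpha>) z :> d \<and> 0 \<le> d"
        using U(1)[of z] U(3) mono[of 0 z] by (intro exI[of _ "U' z"]) simp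
    qed
  next
    case False
    hence "x \<le> 0" by simp
    thus ?thesis
    proof (rule DERIV_nonpos_imp_nonincreasing)
      fix z :: real assume "z \<le> 0"
      thus "\<exists>d. DERIV (frank_potential \<alpha>) z :> d \<and> d \<le> 0"
        using U(1)[of z] U(3) mono[of z 0] by (intro exI[of _ "U' z"]) simp
    qed
  qed
qed

lemma frank_potential_eq:
  assumes "\<bar>x\<bar> < frank_radius \<alpha>"
  shows "frank_potential \<alpha> x = frank_potential \<alpha> 0"
proof -
  from frank_potential_derivatives obtain U' where U:
    "\<And>x. (frank_potential \<alpha> has_real_derivative U' x) (at x)"
    "\<And>x. (U' has_real_derivative (\<alpha> - 1) * frank_riesz \<alpha> x - 1) (at x)" "U' 0 = 0"
    by blast
  define S where "S = {- frank_radius \<alpha><..<frank_radius \<alpha>}"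
  have S: "convex S" "0 \<in> S" "x \<in> S" using frank_radius_pos assms by (auto simp: S_def)
  have "(U' has_real_derivative 0) (at z within S)" if "z \<in> S" for z
    using has_field_derivative_at_within[OF U(2)[of z]] frank_riesz_inside[of z] that
    by (simp add: S_def abs_less_iff)
  then obtain c where c: "\<And>z. z \<in> S \<Longrightarrow> U' z = c"
    using has_field_derivative_zero_constant[OF S(1)] by blast
  have zero: "U' z = 0" if "z \<in> S" for z using U(3) c[OF that] c[OF S(2)] by simp
  have "\<exists>c. \<forall>z\<in>S. frank_potential \<alpha> z = c"
  proof (rule has_field_derivative_zero_constant[OF S(1)])
    fix z assume "z \<in> S"
    thus "(frank_potential \<alpha> has_real_derivative 0) (at z within S)"
      using has_field_derivative_at_within[OF U(1)[of z]] zero[of z] by simp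
  qed
  then obtain c where "\<forall>z\<in>S. frank_potential \<alpha> z = c" ..
  thus ?thesis using S by simp
qed

end

section \<open>Fourier representation of power energies\<close>

text \<open>Subtracting the Taylor polynomial of degree two makes the cosine small enough at zero to be
integrable against \<open>k powr (- 1 - \<alpha>)\<close> for \<open>\<alpha> < 4\<close>, while the quadratic growth at infinity
is integrable for \<open>\<alpha> > 2\<close>.\<close>

definition cos_remainder :: "real \<Rightarrow> real" where
  "cos_remainder u = cos u - 1 + u\<^sup>2 / 2"

lemma cos_remainder_nonneg: "0 \<le> cos_remainder u"
proof -
  have "cos u = 1 - 2 * (sin (u / 2))\<^sup>2" using cos_double_sin[of "u / 2"] by simp
  moreover have "(sin (u / 2))\<^sup>2 \<le> (u / 2)\<^sup>2"
    using abs_sin_x_le_abs_x[of "u / 2"] by (simp only: abs_le_square_iff)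
  ultimately show ?thesis by (simp add: cos_remainder_def power_divide)
qed

lemma cos_remainder_le_square: "cos_remainder u \<le> u\<^sup>2"
  using cos_le_one[of u] zero_le_power2[of u] unfolding cos_remainder_def by linarith

lemma cos_remainder_le_power4: "cos_remainder u \<le> u ^ 4"
proof -
  have "(\<Sum>k\<le>3. (\<i> * complex_of_real u) ^ k / fact k)
      = 1 + \<i> * u - u\<^sup>2 / 2 - \<i> * u ^ 3 / 6"
    by (simp add: eval_nat_numeral fact_numeral power_mult_distrib field_simps)
  hence "Re (iexp u - (\<Sum>k\<le>3. (\<i> * complex_of_real u) ^ k / fact k)) = cos_remainder u"
    by (simp add: cos_remainder_def Re_exp)
  moreover have "cmod (iexp u - (\<Sum>k\<le>3. (\<i> * complex_of_real u) ^ k / fact k)) \<le> \<bar>u\<bar> ^ 4 / 24"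
    using iexp_approx1[of u 3] by (simp add: fact_numeral eval_nat_numeral)
  ultimately have "cos_remainder u \<le> \<bar>u\<bar> ^ 4 / 24"
    by (metis abs_Re_le_cmod abs_le_D1 order_trans)
  moreover have "\<bar>u\<bar> ^ 4 = u ^ 4" "0 \<le> u ^ 4" by simp_all
  ultimately show ?thesis by linarith
qed

lemma measurable_cos_remainder [measurable]: "cos_remainder \<in> borel_measurable borel"
  unfolding cos_remainder_def[abs_def] by measurable

definition fourier_weight :: "real \<Rightarrow> real \<Rightarrow> real" where
  "fourier_weight \<alpha> k = indicator {0<..} k * k powr (- 1 - \<alpha>)"

lemma fourier_weight_nonneg [simp]: "0 \<le> fourier_weight \<alpha> k"
  by (simp add: fourier_weight_def)

lemma measurable_fourier_weight [measurable]: "fourier_weight \<alpha> \<in> borel_measurable borel"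
  unfolding fourier_weight_def[abs_def] by measurable

definition fourier_const :: "real \<Rightarrow> real" where
  "fourier_const \<alpha> = (\<integral>k. fourier_weight \<alpha> k * cos_remainder k \<partial>lborel)"

context
  fixes \<alpha> :: real
  assumes \<alpha>: "2 < \<alpha>" "\<alpha> < 3"
begin

lemma integrable_fourier_const:
  "integrable lborel (\<lambda>k. fourier_weight \<alpha> k * cos_remainder k)"
proof (rule Bochner_Integration.integrable_bound)
  have "set_integrable lebesgue {0..1} (\<lambda>k::real. k powr (3 - \<alpha>))"
    using has_integral_powr_from_0[of "3 - \<alpha>" 1] \<alpha>
    by (intro absolutely_integrable_onI nonnegative_absolutely_integrable_1)
       (auto simp: integrable_on_def)
  hence 1: "set_integrable lborel {0..1} (\<lambda>k::real. k powr (3 - \<alpha>))"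
    unfolding set_integrable_def by (subst (asm) integrable_completion) auto
  have "set_integrable lebesgue {1..} (\<lambda>k::real. k powr (1 - \<alpha>))"
    using has_integral_powr_to_inf[of "1 - \<alpha>" 1] \<alpha>
    by (intro nonnegative_absolutely_integrable_1) (auto simp: integrable_on_def)
  hence 2: "set_integrable lborel {1..} (\<lambda>k::real. k powr (1 - \<alpha>))"
    unfolding set_integrable_def by (subst (asm) integrable_completion) auto
  show "integrable lborel (\<lambda>k. indicat_real {0..1} k *\<^sub>R k powr (3 - \<alpha>)
      + indicat_real {1..} k *\<^sub>R k powr (1 - \<alpha>))"
    using 1 2 unfolding set_integrable_def by (rule Bochner_Integration.integrable_add)
  show "AE k in lborel. norm (fourier_weight \<alpha> k * cos_remainder k)
      \<le> norm (indicat_real {0..1} k *\<^sub>R k powr (3 - \<alpha>) + indicat_real {1..} k *\<^sub>R k powr (1 - \<alpha>))"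
  proof (rule AE_I2)
    fix k :: real
    consider "k \<le> 0" | "0 < k" "k \<le> 1" | "1 < k" by linarith
    thus "norm (fourier_weight \<alpha> k * cos_remainder k)
      \<le> norm (indicat_real {0..1} k *\<^sub>R k powr (3 - \<alpha>) + indicat_real {1..} k *\<^sub>R k powr (1 - \<alpha>))"
    proof cases
      case 1 thus ?thesis by (simp add: fourier_weight_def)
    next
      case 2
      have "k powr (- 1 - \<alpha>) * cos_remainder k \<le> k powr (- 1 - \<alpha>) * k powr 4"
        using cos_remainder_le_power4[of k] 2 by (intro mult_left_mono) auto
      also have "\<dots> = k powr (3 - \<alpha>)" by (simp add: powr_add[symmetric])
      finally have "k powr (- 1 - \<alpha>) * cos_remainder k \<le> k powr (3 - \<alpha>)" .
      thus ?thesis using 2 cos_remainder_nonneg[of k]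
        by (auto simp: fourier_weight_def indicator_def abs_mult add_increasing2)
    next
      case 3
      have "k powr (- 1 - \<alpha>) * cos_remainder k \<le> k powr (- 1 - \<alpha>) * k powr 2"
        using cos_remainder_le_square[of k] 3 by (intro mult_left_mono) auto
      also have "\<dots> = k powr (1 - \<alpha>)" by (simp add: powr_add[symmetric])
      finally have "k powr (- 1 - \<alpha>) * cos_remainder k \<le> k powr (1 - \<alpha>)" .
      thus ?thesis using 3 cos_remainder_nonneg[of k]
        by (auto simp: fourier_weight_def indicator_def abs_mult)
    qed
  qed
qed measurable

lemma fourier_const_pos: "0 < fourier_const \<alpha>"
proof -
  have "0 < (\<integral>k. indicat_real {3..4::real} k * 4 powr (- 1 - \<alpha>) \<partial>lborel)" by simp
  also have "\<dots> \<le> fourier_const \<alpha>"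
    unfolding fourier_const_def
  proof (rule integral_mono)
    fix k :: real
    show "indicat_real {3..4} k * 4 powr (- 1 - \<alpha>) \<le> fourier_weight \<alpha> k * cos_remainder k"
    proof (cases "k \<in> {3..4}")
      case True
      have "9 \<le> k\<^sup>2" using True power_mono[of 3 k 2] by simp
      hence "1 \<le> cos_remainder k"
        unfolding cos_remainder_def using cos_ge_minus_one[of k] by linarith
      moreover have "4 powr (- 1 - \<alpha>) \<le> k powr (- 1 - \<alpha>)"
        using True \<alpha> by (intro powr_mono2') auto
      ultimately have "4 powr (- 1 - \<alpha>) * 1 \<le> k powr (- 1 - \<alpha>) * cos_remainder k"
        by (intro mult_mono) auto
      thus ?thesis using True by (simp add: fourier_weight_def)
    qed (simp add: cos_remainder_nonneg)
  qed (use integrable_fourier_const in auto)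
  finally show ?thesis .
qed

text \<open>The weight is homogeneous and \<open>cos_remainder\<close> is even, so dilating the frequency by
\<open>\<bar>z\<bar>\<close> scales out the power.\<close>

lemma abs_powr_fourier:
  fixes z :: real
  shows "(\<integral>\<^sup>+k. ennreal (fourier_weight \<alpha> k * cos_remainder (k * z)) \<partial>lborel)
    = ennreal (fourier_const \<alpha>) * ennreal (\<bar>z\<bar> powr \<alpha>)"
proof (cases "z = 0")
  case True
  thus ?thesis by (simp add: cos_remainder_def)
next
  case False
  have "(\<integral>\<^sup>+k. ennreal (fourier_weight \<alpha> k * cos_remainder (k * z)) \<partial>lborel)
      = ennreal \<bar>1 / \<bar>z\<bar>\<bar> * (\<integral>\<^sup>+k. ennreal (fourier_weight \<alpha> (0 + 1 / \<bar>z\<bar> * k)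
          * cos_remainder ((0 + 1 / \<bar>z\<bar> * k) * z)) \<partial>lborel)"
    by (rule nn_integral_real_affine) (use False in auto)
  also have "\<dots> = (\<integral>\<^sup>+k. ennreal \<bar>1 / \<bar>z\<bar>\<bar> * ennreal (fourier_weight \<alpha> (0 + 1 / \<bar>z\<bar> * k)
          * cos_remainder ((0 + 1 / \<bar>z\<bar> * k) * z)) \<partial>lborel)"
    by (rule nn_integral_cmult[symmetric]) auto
  also have "\<dots> = (\<integral>\<^sup>+k. ennreal (\<bar>z\<bar> powr \<alpha>) * ennreal (fourier_weight \<alpha> k * cos_remainder k) \<partial>lborel)"
  proof (rule nn_integral_cong)
    fix k :: real
    have c: "cos_remainder (k / \<bar>z\<bar> * z) = cos_remainder k"
      using False by (cases "z > 0") (auto simp: cos_remainder_def)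
    have w: "1 / \<bar>z\<bar> * fourier_weight \<alpha> (k / \<bar>z\<bar>) = \<bar>z\<bar> powr \<alpha> * fourier_weight \<alpha> k"
    proof (cases "k > 0")
      case True
      have "\<bar>z\<bar> powr (1 + \<alpha>) = \<bar>z\<bar> * \<bar>z\<bar> powr \<alpha>"
        using False by (simp add: powr_add)
      moreover have "(k / \<bar>z\<bar>) powr (- 1 - \<alpha>) = k powr (- 1 - \<alpha>) * \<bar>z\<bar> powr (1 + \<alpha>)"
        using True False powr_minus_divide[of "\<bar>z\<bar>" "1 + \<alpha>"]
        by (simp add: powr_divide)
      ultimately show ?thesis using True False by (simp add: fourier_weight_def)
    qed (use False in \<open>simp add: fourier_weight_def field_simps\<close>)
    have "1 / \<bar>z\<bar> * (fourier_weight \<alpha> (k / \<bar>z\<bar>) * cos_remainder (k / \<bar>z\<bar> * z))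
        = \<bar>z\<bar> powr \<alpha> * (fourier_weight \<alpha> k * cos_remainder k)"
      unfolding c using w by (metis mult.assoc)
    thus "ennreal \<bar>1 / \<bar>z\<bar>\<bar> * ennreal (fourier_weight \<alpha> (0 + 1 / \<bar>z\<bar> * k)
          * cos_remainder ((0 + 1 / \<bar>z\<bar> * k) * z))
        = ennreal (\<bar>z\<bar> powr \<alpha>) * ennreal (fourier_weight \<alpha> k * cos_remainder k)"
      by (simp flip: ennreal_mult')
  qed
  also have "\<dots> = ennreal (\<bar>z\<bar> powr \<alpha>) * (\<integral>\<^sup>+k. ennreal (fourier_weight \<alpha> k * cos_remainder k) \<partial>lborel)"
    by (rule nn_integral_cmult) auto
  also have "(\<integral>\<^sup>+k. ennreal (fourier_weight \<alpha> k * cos_remainder k) \<partial>lborel) = ennreal (fourier_const \<alpha>)"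
    unfolding fourier_const_def
    by (rule nn_integral_eq_integral) (use integrable_fourier_const cos_remainder_nonneg in auto)
  finally show ?thesis by (simp add: mult.commute)
qed

end

definition finite_moment :: "real \<Rightarrow> real measure set" where
  "finite_moment \<alpha> = {\<mu> \<in> prob_measures. integrable \<mu> (\<lambda>x. \<bar>x\<bar> powr \<alpha>)}"

definition powr_energy :: "real \<Rightarrow> real measure \<Rightarrow> real measure \<Rightarrow> real" where
  "powr_energy p \<mu> \<nu> = (\<integral>z. \<bar>fst z - snd z\<bar> powr p \<partial>(\<mu> \<Otimes>\<^sub>M \<nu>))"

lemma finite_momentD:
  assumes "\<mu> \<in> finite_moment \<alpha>"
  shows "prob_space \<mu>" "sets \<mu> = sets borel" "space \<mu> = UNIV" "integrable \<mu> (\<lambda>x. \<bar>x\<bar> powr \<alpha>)"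
    "real_distribution \<mu>"
proof -
  show 1: "prob_space \<mu>" and 2: "sets \<mu> = sets borel" and "integrable \<mu> (\<lambda>x. \<bar>x\<bar> powr \<alpha>)"
    using assms by (auto simp: finite_moment_def prob_measures_def)
  from 2 show "space \<mu> = UNIV" by (metis sets_eq_imp_space_eq space_borel)
  from 1 2 show "real_distribution \<mu>"
    by (simp add: real_distribution_def real_distribution_axioms_def)
qed

lemma pair_prob_spaceI: "prob_space \<mu> \<Longrightarrow> prob_space \<nu> \<Longrightarrow> pair_prob_space \<mu> \<nu>"
  by (simp add: pair_prob_space_def pair_sigma_finite_def prob_space_imp_sigma_finite)

lemma powr_le_one_plus_powr:
  fixes z p a :: real
  assumes "0 \<le> z" "0 < p" "p \<le> a"
  shows "z powr p \<le> 1 + z powr a"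
proof (cases "z \<le> 1")
  case True
  hence "z powr p \<le> 1" using powr_mono2[of p z 1] assms by simp
  thus ?thesis by (simp add: add_increasing2)
next
  case False
  hence "z powr p \<le> z powr a" using assms by (intro powr_mono) auto
  thus ?thesis by simp
qed

lemma abs_diff_powr_le:
  fixes x y a :: real
  assumes "0 < a"
  shows "\<bar>x - y\<bar> powr a \<le> 2 powr a * (\<bar>x\<bar> powr a + \<bar>y\<bar> powr a)"
proof -
  have "\<bar>x - y\<bar> powr a \<le> (2 * max \<bar>x\<bar> \<bar>y\<bar>) powr a"
    using assms by (intro powr_mono2) auto
  also have "\<dots> = 2 powr a * max \<bar>x\<bar> \<bar>y\<bar> powr a" by (simp add: powr_mult)
  also have "\<dots> \<le> 2 powr a * (\<bar>x\<bar> powr a + \<bar>y\<bar> powr a)"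
    by (intro mult_left_mono) (auto simp: max_def)
  finally show ?thesis .
qed

lemma finite_moment_lower:
  assumes \<mu>: "\<mu> \<in> finite_moment \<alpha>" and p: "0 < p" "p \<le> \<alpha>"
  shows "integrable \<mu> (\<lambda>x. \<bar>x\<bar> powr p)"
proof -
  interpret real_distribution \<mu> using \<mu> by (rule finite_momentD)
  show ?thesis
    by (rule Bochner_Integration.integrable_bound[of _ "\<lambda>x. 1 + \<bar>x\<bar> powr \<alpha>"])
       (use finite_momentD(4)[OF \<mu>] p powr_le_one_plus_powr in auto)
qed

lemma integrable_powr_energy:
  assumes \<mu>: "\<mu> \<in> finite_moment \<alpha>" and \<nu>: "\<nu> \<in> finite_moment \<alpha>" and p: "0 < p" "p \<le> \<alpha>"
  shows "integrable (\<mu> \<Otimes>\<^sub>M \<nu>) (\<lambda>z. \<bar>fst z - snd z\<bar> powr p)"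
proof -
  interpret M: real_distribution \<mu> using \<mu> by (rule finite_momentD)
  interpret N: real_distribution \<nu> using \<nu> by (rule finite_momentD)
  interpret pair_prob_space \<mu> \<nu> by (intro pair_prob_spaceI M.prob_space_axioms N.prob_space_axioms)
  have 1: "integrable (\<mu> \<Otimes>\<^sub>M \<nu>) (\<lambda>z. \<bar>fst z\<bar> powr p)"
    using finite_moment_lower[OF \<mu> p] N.distr_pair_fst[of \<mu>]
    by (subst integrable_distr_eq[of fst "\<mu> \<Otimes>\<^sub>M \<nu>" \<mu>, symmetric, where f = "\<lambda>x. \<bar>x\<bar> powr p"]) auto
  interpret S: pair_prob_space \<nu> \<mu> by (intro pair_prob_spaceI M.prob_space_axioms N.prob_space_axioms)
  have "integrable (\<nu> \<Otimes>\<^sub>M \<mu>) (\<lambda>z. \<bar>fst z\<bar> powr p)"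
    using finite_moment_lower[OF \<nu> p] M.distr_pair_fst[of \<nu>]
    by (subst integrable_distr_eq[of fst "\<nu> \<Otimes>\<^sub>M \<mu>" \<nu>, symmetric, where f = "\<lambda>x. \<bar>x\<bar> powr p"]) auto
  hence 2: "integrable (\<mu> \<Otimes>\<^sub>M \<nu>) (\<lambda>z. \<bar>snd z\<bar> powr p)"
    using S.integrable_product_swap[of "\<lambda>z. \<bar>fst z\<bar> powr p"] by (simp add: case_prod_beta')
  show ?thesis
    by (rule Bochner_Integration.integrable_bound
          [of _ "\<lambda>z. 2 powr p * (\<bar>fst z\<bar> powr p + \<bar>snd z\<bar> powr p)"])
       (use 1 2 p abs_diff_powr_le in auto)
qed

lemma integrable_second_moment:
  assumes "\<mu> \<in> finite_moment \<alpha>" "2 \<le> \<alpha>"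
  shows "integrable \<mu> (\<lambda>x. x)" "integrable \<mu> (\<lambda>x. x\<^sup>2)"
proof -
  interpret real_distribution \<mu> using assms(1) by (rule finite_momentD)
  have 1: "integrable \<mu> (\<lambda>x. \<bar>x\<bar> powr 1)"
    by (rule finite_moment_lower[OF assms(1)]) (use assms(2) in auto)
  show "integrable \<mu> (\<lambda>x. x)"
    by (rule Bochner_Integration.integrable_bound[OF 1]) auto
  have 2: "integrable \<mu> (\<lambda>x. \<bar>x\<bar> powr 2)"
    by (rule finite_moment_lower[OF assms(1)]) (use assms(2) in auto)
  show "integrable \<mu> (\<lambda>x. x\<^sup>2)"
    by (rule Bochner_Integration.integrable_bound[OF 2]) auto
qed

lemma char_cos_sin:
  assumes "real_distribution \<mu>"
  shows "char \<mu> k = Complex (\<integral>x. cos (k * x) \<partial>\<mu>) (\<integral>x. sin (k * x) \<partial>\<mu>)"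
proof -
  interpret real_distribution \<mu> by fact
  show ?thesis
    unfolding char_def
    by (rule complex_eqI) (simp_all add: integrable_iexp integral_Re[symmetric] integral_Im[symmetric] Re_exp Im_exp)
qed

text \<open>The integral of \<open>cos_remainder (k (x - y))\<close> against the product of two centred measures; the
mixed term of the square drops out because the means vanish.\<close>

definition fourier_pairing :: "real measure \<Rightarrow> real measure \<Rightarrow> real \<Rightarrow> real" where
  "fourier_pairing \<mu> \<nu> k = Re (char \<mu> k * cnj (char \<nu> k)) - 1
    + k\<^sup>2 * ((\<integral>x. x\<^sup>2 \<partial>\<mu>) + (\<integral>x. x\<^sup>2 \<partial>\<nu>)) / 2"

lemma cos_remainder_pairing:
  assumes \<mu>: "\<mu> \<in> finite_moment \<alpha>" "(\<integral>x. x \<partial>\<mu>) = 0"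
    and \<nu>: "\<nu> \<in> finite_moment \<alpha>" "(\<integral>x. x \<partial>\<nu>) = 0" and \<alpha>: "2 \<le> \<alpha>"
  shows "(\<integral>\<^sup>+x. \<integral>\<^sup>+y. ennreal (cos_remainder (k * (x - y))) \<partial>\<nu> \<partial>\<mu>) = ennreal (fourier_pairing \<mu> \<nu> k)"
    and "0 \<le> fourier_pairing \<mu> \<nu> k"
proof -
  interpret M: real_distribution \<mu> using \<mu>(1) by (rule finite_momentD)
  interpret N: real_distribution \<nu> using \<nu>(1) by (rule finite_momentD)
  note int = integrable_second_moment[OF \<mu>(1) \<alpha>] integrable_second_moment[OF \<nu>(1) \<alpha>]
  have trig: "integrable \<mu> (\<lambda>x. cos (k * x))" "integrable \<mu> (\<lambda>x. sin (k * x))"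
    "integrable \<nu> (\<lambda>x. cos (k * x))" "integrable \<nu> (\<lambda>x. sin (k * x))"
    by (auto intro!: M.integrable_const_bound[of _ 1] N.integrable_const_bound[of _ 1])
  define C where "C = (\<integral>y. cos (k * y) \<partial>\<nu>)"
  define S where "S = (\<integral>y. sin (k * y) \<partial>\<nu>)"
  define m where "m = (\<integral>y. y\<^sup>2 \<partial>\<nu>)"
  have expand: "cos_remainder (k * (x - y)) = cos (k * x) * cos (k * y) + sin (k * x) * sin (k * y)
      - 1 + k\<^sup>2 / 2 * x\<^sup>2 - k\<^sup>2 * x * y + k\<^sup>2 / 2 * y\<^sup>2" for x y
    unfolding cos_remainder_def right_diff_distrib cos_diff
    by (simp add: power2_eq_square field_simps)
  have inner_int: "integrable \<nu> (\<lambda>y. cos_remainder (k * (x - y)))" for x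
    unfolding expand using int trig by auto
  define g where "g x = cos (k * x) * C + sin (k * x) * S - 1 + k\<^sup>2 / 2 * x\<^sup>2 + k\<^sup>2 / 2 * m" for x
  have inner: "(\<integral>y. cos_remainder (k * (x - y)) \<partial>\<nu>) = g x" for x
    unfolding expand g_def C_def S_def m_def using int trig \<nu>(2) N.prob_space by simp
  have g0: "0 \<le> g x" for x
    unfolding inner[symmetric] by (intro integral_nonneg_AE AE_I2 cos_remainder_nonneg)
  have g_int: "integrable \<mu> g" unfolding g_def using int trig by auto
  have "(\<integral>x. g x \<partial>\<mu>) = (\<integral>x. cos (k * x) \<partial>\<mu>) * C + (\<integral>x. sin (k * x) \<partial>\<mu>) * S - 1
      + k\<^sup>2 / 2 * (\<integral>x. x\<^sup>2 \<partial>\<mu>) + k\<^sup>2 / 2 * m"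
    unfolding g_def using int trig M.prob_space by simp
  also have "\<dots> = fourier_pairing \<mu> \<nu> k"
    unfolding fourier_pairing_def char_cos_sin[OF M.real_distribution_axioms]
      char_cos_sin[OF N.real_distribution_axioms] C_def S_def m_def
    by (simp add: field_simps)
  finally have g: "(\<integral>x. g x \<partial>\<mu>) = fourier_pairing \<mu> \<nu> k" .
  have "(\<integral>\<^sup>+y. ennreal (cos_remainder (k * (x - y))) \<partial>\<nu>) = ennreal (g x)" for x
    unfolding inner[symmetric]
    by (rule nn_integral_eq_integral) (use inner_int cos_remainder_nonneg in auto)
  hence "(\<integral>\<^sup>+x. \<integral>\<^sup>+y. ennreal (cos_remainder (k * (x - y))) \<partial>\<nu> \<partial>\<mu>) = (\<integral>\<^sup>+x. ennreal (g x) \<partial>\<mu>)"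
    by simp
  also have "\<dots> = ennreal (fourier_pairing \<mu> \<nu> k)"
    unfolding g[symmetric] by (rule nn_integral_eq_integral) (use g_int g0 in auto)
  finally show "(\<integral>\<^sup>+x. \<integral>\<^sup>+y. ennreal (cos_remainder (k * (x - y))) \<partial>\<nu> \<partial>\<mu>)
      = ennreal (fourier_pairing \<mu> \<nu> k)" .
  show "0 \<le> fourier_pairing \<mu> \<nu> k"
    unfolding g[symmetric] by (intro integral_nonneg_AE AE_I2 g0)
qed

text \<open>Tonelli's theorem applies since \<open>cos_remainder\<close> is nonnegative, and integrability over the
frequencies is a consequence of the finiteness of the power energy.\<close>

lemma powr_energy_fourier:
  assumes \<alpha>: "2 < \<alpha>" "\<alpha> < 3"
    and \<mu>: "\<mu> \<in> finite_moment \<alpha>" "(\<integral>x. x \<partial>\<mu>) = 0"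
    and \<nu>: "\<nu> \<in> finite_moment \<alpha>" "(\<integral>x. x \<partial>\<nu>) = 0"
  shows "integrable lborel (\<lambda>k. fourier_weight \<alpha> k * fourier_pairing \<mu> \<nu> k)"
    and "(\<integral>k. fourier_weight \<alpha> k * fourier_pairing \<mu> \<nu> k \<partial>lborel) = fourier_const \<alpha> * powr_energy \<alpha> \<mu> \<nu>"
proof -
  interpret M: real_distribution \<mu> using \<mu>(1) by (rule finite_momentD)
  interpret N: real_distribution \<nu> using \<nu>(1) by (rule finite_momentD)
  interpret P: pair_prob_space \<mu> \<nu> by (intro pair_prob_spaceI M.prob_space_axioms N.prob_space_axioms)
  interpret T: pair_sigma_finite "\<mu> \<Otimes>\<^sub>M \<nu>" lborel ..
  note pairing = cos_remainder_pairing[OF \<mu> \<nu> less_imp_le[OF \<alpha>(1)]]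
  have [measurable]: "fourier_pairing \<mu> \<nu> \<in> borel_measurable borel"
    unfolding fourier_pairing_def[abs_def]
    using M.char_measurable N.char_measurable by simp
  have int: "integrable (\<mu> \<Otimes>\<^sub>M \<nu>) (\<lambda>z. \<bar>fst z - snd z\<bar> powr \<alpha>)"
    by (rule integrable_powr_energy[OF \<mu>(1) \<nu>(1)]) (use \<alpha> in auto)
  have "(\<integral>\<^sup>+k. ennreal (fourier_weight \<alpha> k * fourier_pairing \<mu> \<nu> k) \<partial>lborel)
      = (\<integral>\<^sup>+k. ennreal (fourier_weight \<alpha> k) * (\<integral>\<^sup>+z. ennreal (cos_remainder (k * (fst z - snd z))) \<partial>(\<mu> \<Otimes>\<^sub>M \<nu>)) \<partial>lborel)"
  proof (rule nn_integral_cong)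
    fix k
    have "(\<integral>\<^sup>+z. ennreal (cos_remainder (k * (fst z - snd z))) \<partial>(\<mu> \<Otimes>\<^sub>M \<nu>))
        = (\<integral>\<^sup>+x. \<integral>\<^sup>+y. ennreal (cos_remainder (k * (x - y))) \<partial>\<nu> \<partial>\<mu>)"
      by (subst N.nn_integral_fst[symmetric]) auto
    thus "ennreal (fourier_weight \<alpha> k * fourier_pairing \<mu> \<nu> k) = ennreal (fourier_weight \<alpha> k)
        * (\<integral>\<^sup>+z. ennreal (cos_remainder (k * (fst z - snd z))) \<partial>(\<mu> \<Otimes>\<^sub>M \<nu>))"
      using pairing by (simp add: ennreal_mult')
  qed
  also have "\<dots> = (\<integral>\<^sup>+k. \<integral>\<^sup>+z. ennreal (fourier_weight \<alpha> k * cos_remainder (k * (fst z - snd z))) \<partial>(\<mu> \<Otimes>\<^sub>M \<nu>) \<partial>lborel)"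
    by (intro nn_integral_cong, subst nn_integral_cmult[symmetric]) (auto simp: ennreal_mult')
  also have "\<dots> = (\<integral>\<^sup>+z. \<integral>\<^sup>+k. ennreal (fourier_weight \<alpha> k * cos_remainder (k * (fst z - snd z))) \<partial>lborel \<partial>(\<mu> \<Otimes>\<^sub>M \<nu>))"
    by (rule T.Fubini') measurable
  also have "\<dots> = (\<integral>\<^sup>+z. ennreal (fourier_const \<alpha>) * ennreal (\<bar>fst z - snd z\<bar> powr \<alpha>) \<partial>(\<mu> \<Otimes>\<^sub>M \<nu>))"
    by (simp add: abs_powr_fourier[OF \<alpha>])
  also have "\<dots> = ennreal (fourier_const \<alpha>) * (\<integral>\<^sup>+z. ennreal (\<bar>fst z - snd z\<bar> powr \<alpha>) \<partial>(\<mu> \<Otimes>\<^sub>M \<nu>))"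
    by (rule nn_integral_cmult) measurable
  also have "(\<integral>\<^sup>+z. ennreal (\<bar>fst z - snd z\<bar> powr \<alpha>) \<partial>(\<mu> \<Otimes>\<^sub>M \<nu>)) = ennreal (powr_energy \<alpha> \<mu> \<nu>)"
    unfolding powr_energy_def by (rule nn_integral_eq_integral) (use int in auto)
  also have "ennreal (fourier_const \<alpha>) * \<dots> = ennreal (fourier_const \<alpha> * powr_energy \<alpha> \<mu> \<nu>)"
    using fourier_const_pos[OF \<alpha>] by (simp add: ennreal_mult')
  finally have eq: "(\<integral>\<^sup>+k. ennreal (fourier_weight \<alpha> k * fourier_pairing \<mu> \<nu> k) \<partial>lborel)
      = ennreal (fourier_const \<alpha> * powr_energy \<alpha> \<mu> \<nu>)" .
  have "0 \<le> powr_energy \<alpha> \<mu> \<nu>"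
    unfolding powr_energy_def by (intro integral_nonneg_AE AE_I2) simp
  hence nonneg: "0 \<le> fourier_const \<alpha> * powr_energy \<alpha> \<mu> \<nu>"
    using fourier_const_pos[OF \<alpha>] by simp
  show "integrable lborel (\<lambda>k. fourier_weight \<alpha> k * fourier_pairing \<mu> \<nu> k)"
    by (rule integrableI_nonneg) (use eq pairing in auto)
  show "(\<integral>k. fourier_weight \<alpha> k * fourier_pairing \<mu> \<nu> k \<partial>lborel) = fourier_const \<alpha> * powr_energy \<alpha> \<mu> \<nu>"
    by (subst integral_eq_nn_integral) (use eq nonneg pairing in auto)
qed

text \<open>In the second difference the constants and the second moments cancel, and the three products of
characteristic functions combine to a square.  This is the strict convexity of the energy on centred
measures.\<close>

lemma powr_energy_char_diff:
  assumes \<alpha>: "2 < \<alpha>" "\<alpha> < 3"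
    and \<mu>: "\<mu> \<in> finite_moment \<alpha>" "(\<integral>x. x \<partial>\<mu>) = 0"
    and \<nu>: "\<nu> \<in> finite_moment \<alpha>" "(\<integral>x. x \<partial>\<nu>) = 0"
  defines "d \<equiv> \<lambda>k. fourier_weight \<alpha> k * (cmod (char \<mu> k - char \<nu> k))\<^sup>2"
  shows "integrable lborel d"
    and "(\<integral>k. d k \<partial>lborel)
      = fourier_const \<alpha> * (powr_energy \<alpha> \<mu> \<mu> + powr_energy \<alpha> \<nu> \<nu> - 2 * powr_energy \<alpha> \<mu> \<nu>)"
proof -
  have sq: "(cmod (a - b))\<^sup>2 = Re (a * cnj a) + Re (b * cnj b) - 2 * Re (a * cnj b)" for a b :: complex
    unfolding cmod_power2 by (simp add: power2_eq_square algebra_simps)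
  have d: "d = (\<lambda>k. fourier_weight \<alpha> k * fourier_pairing \<mu> \<mu> k + fourier_weight \<alpha> k * fourier_pairing \<nu> \<nu> k
      - 2 * (fourier_weight \<alpha> k * fourier_pairing \<mu> \<nu> k))"
    unfolding d_def sq fourier_pairing_def by (rule ext) (simp add: field_simps)
  note f = powr_energy_fourier[OF \<alpha> \<mu> \<mu>] powr_energy_fourier[OF \<alpha> \<nu> \<nu>] powr_energy_fourier[OF \<alpha> \<mu> \<nu>]
  show "integrable lborel d" unfolding d using f by auto
  show "(\<integral>k. d k \<partial>lborel)
      = fourier_const \<alpha> * (powr_energy \<alpha> \<mu> \<mu> + powr_energy \<alpha> \<nu> \<nu> - 2 * powr_energy \<alpha> \<mu> \<nu>)"
    unfolding d using f by (simp add: algebra_simps)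
qed

lemma powr_energy_two:
  assumes \<mu>: "\<mu> \<in> finite_moment \<alpha>" "(\<integral>x. x \<partial>\<mu>) = 0"
    and \<nu>: "\<nu> \<in> finite_moment \<alpha>" "(\<integral>x. x \<partial>\<nu>) = 0" and \<alpha>: "2 \<le> \<alpha>"
  shows "powr_energy 2 \<mu> \<nu> = (\<integral>x. x\<^sup>2 \<partial>\<mu>) + (\<integral>x. x\<^sup>2 \<partial>\<nu>)"
proof -
  interpret M: real_distribution \<mu> using \<mu>(1) by (rule finite_momentD)
  interpret N: real_distribution \<nu> using \<nu>(1) by (rule finite_momentD)
  interpret P: pair_prob_space \<mu> \<nu> by (intro pair_prob_spaceI M.prob_space_axioms N.prob_space_axioms)
  note int = integrable_second_moment[OF \<mu>(1) \<alpha>] integrable_second_moment[OF \<nu>(1) \<alpha>]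
  have "powr_energy 2 \<mu> \<nu> = (\<integral>x. \<integral>y. \<bar>x - y\<bar> powr 2 \<partial>\<nu> \<partial>\<mu>)"
    unfolding powr_energy_def
    by (subst P.integral_fst'[symmetric]) (use integrable_powr_energy[OF \<mu>(1) \<nu>(1), of 2] \<alpha> in auto)
  also have "\<dots> = (\<integral>x. \<integral>y. x\<^sup>2 - 2 * x * y + y\<^sup>2 \<partial>\<nu> \<partial>\<mu>)"
    by (simp add: power2_diff algebra_simps)
  also have "\<dots> = (\<integral>x. x\<^sup>2 + (\<integral>y. y\<^sup>2 \<partial>\<nu>) \<partial>\<mu>)"
    using int \<nu>(2) N.prob_space by simp
  also have "\<dots> = (\<integral>x. x\<^sup>2 \<partial>\<mu>) + (\<integral>x. x\<^sup>2 \<partial>\<nu>)"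
    using int M.prob_space by simp
  finally show ?thesis .
qed

section \<open>Energies of measures with finite moments\<close>

lemma powr_absorb:
  fixes a b e :: real
  assumes "0 < b" "b < a" "0 < e"
  obtains C where "0 \<le> C" "\<And>z. 0 \<le> z \<Longrightarrow> z powr b \<le> e * z powr a + C"
proof -
  \<comment> \<open>beyond this threshold the estimate holds without an additive constant\<close>
  define M where "M = e powr (1 / (b - a))"
  have M: "0 < M" "M powr (b - a) = e" using assms by (auto simp: M_def powr_powr)
  show ?thesis
  proof (rule that[of "M powr b"])
    fix z :: real assume z: "0 \<le> z"
    show "z powr b \<le> e * z powr a + M powr b"
    proof (cases "z \<le> M")
      case True
      hence "z powr b \<le> M powr b" using z assms by (intro powr_mono2) auto
      thus ?thesis using assms by (simp add: add_increasing)
    next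
      case False
      have "z powr b = z powr (b - a) * z powr a" using False M by (simp add: powr_diff)
      also have "\<dots> \<le> M powr (b - a) * z powr a"
        using False M assms by (intro mult_right_mono powr_mono2') auto
      finally show ?thesis by (simp add: M add_increasing2)
    qed
  qed simp
qed

text \<open>Twice the energy, as a bilinear form in two measures with finite moments.\<close>

definition energy_real :: "real \<Rightarrow> real \<Rightarrow> real measure \<Rightarrow> real measure \<Rightarrow> real" where
  "energy_real \<alpha> \<beta> \<mu> \<nu> = powr_energy \<alpha> \<mu> \<nu> / \<alpha> - powr_energy \<beta> \<mu> \<nu> / \<beta>"

lemma energy_eq_energy_real:
  assumes \<mu>: "\<mu> \<in> finite_moment \<alpha>" and \<beta>: "0 < \<beta>" "\<beta> \<le> \<alpha>"
  shows "energy \<alpha> \<beta> \<mu> = ereal (energy_real \<alpha> \<beta> \<mu> \<mu> / 2)"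
proof -
  have k: "kernel \<alpha> \<beta> = (\<lambda>z. \<bar>fst z - snd z\<bar> powr \<alpha> / \<alpha> - \<bar>fst z - snd z\<bar> powr \<beta> / \<beta>)"
    by (auto simp: kernel_def)
  have int: "integrable (\<mu> \<Otimes>\<^sub>M \<mu>) (\<lambda>z. \<bar>fst z - snd z\<bar> powr \<alpha>)"
    "integrable (\<mu> \<Otimes>\<^sub>M \<mu>) (\<lambda>z. \<bar>fst z - snd z\<bar> powr \<beta>)"
    using integrable_powr_energy[OF \<mu> \<mu>] \<beta> by auto
  hence ki: "integrable (\<mu> \<Otimes>\<^sub>M \<mu>) (kernel \<alpha> \<beta>)" unfolding k by auto
  have kv: "(\<integral>z. kernel \<alpha> \<beta> z \<partial>(\<mu> \<Otimes>\<^sub>M \<mu>)) = energy_real \<alpha> \<beta> \<mu> \<mu>"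
    unfolding k energy_real_def powr_energy_def using int by simp
  obtain A where A: "(\<integral>\<^sup>+z. ennreal (kernel \<alpha> \<beta> z) \<partial>(\<mu> \<Otimes>\<^sub>M \<mu>)) = ennreal A" "0 \<le> A"
    using ki unfolding real_integrable_def by (metis ennreal_cases infinity_ennreal_def)
  obtain B where B: "(\<integral>\<^sup>+z. ennreal (- kernel \<alpha> \<beta> z) \<partial>(\<mu> \<Otimes>\<^sub>M \<mu>)) = ennreal B" "0 \<le> B"
    using ki unfolding real_integrable_def by (metis ennreal_cases infinity_ennreal_def)
  have "energy_real \<alpha> \<beta> \<mu> \<mu> = A - B"
    using real_lebesgue_integral_def[OF ki] A B by (simp add: kv)
  thus ?thesis unfolding energy_def A(1) B(1) using A(2) B(2) by simp
qed

text \<open>The kernel is bounded below by \<open>\<bar>x - y\<bar> powr \<alpha> / (2 \<alpha>)\<close> minus a constant.  Finite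
energy thus makes the double integral of \<open>\<bar>x - y\<bar> powr \<alpha>\<close> finite, hence the integral over
\<open>y\<close> for some fixed \<open>x\<close>, and this bounds the moment.\<close>

lemma finite_moment_of_finite_energy:
  assumes \<mu>: "\<mu> \<in> prob_measures" and \<beta>: "0 < \<beta>" "\<beta> < \<alpha>" and fin: "energy \<alpha> \<beta> \<mu> \<noteq> \<infinity>"
  shows "\<mu> \<in> finite_moment \<alpha>"
proof -
  have "prob_space \<mu>" "sets \<mu> = sets borel" using \<mu> by (auto simp: prob_measures_def)
  hence "real_distribution \<mu>" by (simp add: real_distribution_def real_distribution_axioms_def)
  then interpret M: real_distribution \<mu> .
  interpret P: pair_prob_space \<mu> \<mu> by (intro pair_prob_spaceI M.prob_space_axioms)
  have k: "kernel \<alpha> \<beta> = (\<lambda>z::real \<times> real. \<bar>fst z - snd z\<bar> powr \<alpha> / \<alpha> - \<bar>fst z - snd z\<bar> powr \<beta> / \<beta>)"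
    by (auto simp: kernel_def)
  have [measurable]: "(kernel \<alpha> \<beta> :: real \<times> real \<Rightarrow> real) \<in> borel_measurable (\<mu> \<Otimes>\<^sub>M \<mu>)"
    unfolding k by measurable
  obtain C where C: "0 \<le> C" "\<And>z. 0 \<le> z \<Longrightarrow> z powr \<beta> \<le> (\<beta> / (2 * \<alpha>)) * z powr \<alpha> + C"
    using powr_absorb[of \<beta> \<alpha> "\<beta> / (2 * \<alpha>)"] \<beta> by auto
  have lower: "\<bar>fst z - snd z\<bar> powr \<alpha> / (2 * \<alpha>) \<le> kernel \<alpha> \<beta> z + C / \<beta>" for z :: "real \<times> real"
  proof -
    have "\<bar>fst z - snd z\<bar> powr \<beta> / \<beta> \<le> ((\<beta> / (2 * \<alpha>)) * \<bar>fst z - snd z\<bar> powr \<alpha> + C) / \<beta>"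
      using C(2) \<beta> by (intro divide_right_mono) auto
    also have "\<dots> = \<bar>fst z - snd z\<bar> powr \<alpha> / (2 * \<alpha>) + C / \<beta>"
      using \<beta> by (simp add: add_divide_distrib)
    finally show ?thesis unfolding k by (simp add: field_simps)
  qed
  have "(\<integral>\<^sup>+z. ennreal (- kernel \<alpha> \<beta> z) \<partial>(\<mu> \<Otimes>\<^sub>M \<mu>)) \<le> (\<integral>\<^sup>+z. ennreal (C / \<beta>) \<partial>(\<mu> \<Otimes>\<^sub>M \<mu>))"
  proof (intro nn_integral_mono ennreal_leI)
    fix z :: "real \<times> real"
    have "0 \<le> \<bar>fst z - snd z\<bar> powr \<alpha> / (2 * \<alpha>)" using \<beta> by simp
    thus "- kernel \<alpha> \<beta> z \<le> C / \<beta>" using lower[of z] by linarith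
  qed
  also have "\<dots> = ennreal (C / \<beta>)" using P.emeasure_space_1 by simp
  also have "\<dots> < \<infinity>" by simp
  finally have neg: "(\<integral>\<^sup>+z. ennreal (- kernel \<alpha> \<beta> z) \<partial>(\<mu> \<Otimes>\<^sub>M \<mu>)) < \<infinity>" .
  then obtain B where B: "(\<integral>\<^sup>+z. ennreal (- kernel \<alpha> \<beta> z) \<partial>(\<mu> \<Otimes>\<^sub>M \<mu>)) = ennreal B" "0 \<le> B"
    by (metis ennreal_cases infinity_ennreal_def less_irrefl)
  have pos: "(\<integral>\<^sup>+z. ennreal (kernel \<alpha> \<beta> z) \<partial>(\<mu> \<Otimes>\<^sub>M \<mu>)) < \<infinity>"
  proof (rule ccontr)
    assume "\<not> ?thesis"
    hence "(\<integral>\<^sup>+z. ennreal (kernel \<alpha> \<beta> z) \<partial>(\<mu> \<Otimes>\<^sub>M \<mu>)) = \<infinity>"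
      by (auto simp: less_top[symmetric])
    hence "energy \<alpha> \<beta> \<mu> = \<infinity>" unfolding energy_def B(1) using B(2) by simp
    thus False using fin by simp
  qed
  have "(\<integral>\<^sup>+x. \<integral>\<^sup>+y. ennreal (\<bar>x - y\<bar> powr \<alpha>) \<partial>\<mu> \<partial>\<mu>) = (\<integral>\<^sup>+z. ennreal (\<bar>fst z - snd z\<bar> powr \<alpha>) \<partial>(\<mu> \<Otimes>\<^sub>M \<mu>))"
    by (subst M.nn_integral_fst[symmetric]) auto
  also have "\<dots> \<le> (\<integral>\<^sup>+z. ennreal (2 * \<alpha>) * (ennreal (kernel \<alpha> \<beta> z) + ennreal (C / \<beta>)) \<partial>(\<mu> \<Otimes>\<^sub>M \<mu>))"
  proof (intro nn_integral_mono)
    fix z :: "real \<times> real"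
    have "\<bar>fst z - snd z\<bar> powr \<alpha> \<le> (2 * \<alpha>) * (max 0 (kernel \<alpha> \<beta> z) + C / \<beta>)"
    proof -
      have "\<bar>fst z - snd z\<bar> powr \<alpha> \<le> (kernel \<alpha> \<beta> z + C / \<beta>) * (2 * \<alpha>)"
        using lower[of z] \<beta> by (subst (asm) pos_divide_le_eq) auto
      also have "\<dots> \<le> (max 0 (kernel \<alpha> \<beta> z) + C / \<beta>) * (2 * \<alpha>)"
        using \<beta> by (intro mult_right_mono) auto
      finally show ?thesis by (simp only: mult.commute)
    qed
    hence "ennreal (\<bar>fst z - snd z\<bar> powr \<alpha>) \<le> ennreal ((2 * \<alpha>) * (max 0 (kernel \<alpha> \<beta> z) + C / \<beta>))"
      by (rule ennreal_leI)
    also have "\<dots> = ennreal (2 * \<alpha>) * (ennreal (max 0 (kernel \<alpha> \<beta> z)) + ennreal (C / \<beta>))"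
      using \<beta> C(1) by (subst ennreal_mult) (auto simp: ennreal_plus)
    finally show "ennreal (\<bar>fst z - snd z\<bar> powr \<alpha>)
        \<le> ennreal (2 * \<alpha>) * (ennreal (kernel \<alpha> \<beta> z) + ennreal (C / \<beta>))"
      by (simp add: ennreal_max_0)
  qed
  also have "\<dots> = ennreal (2 * \<alpha>) * ((\<integral>\<^sup>+z. ennreal (kernel \<alpha> \<beta> z) \<partial>(\<mu> \<Otimes>\<^sub>M \<mu>)) + ennreal (C / \<beta>))"
    using P.emeasure_space_1 by (simp add: nn_integral_cmult nn_integral_add)
  also have "\<dots> < \<infinity>" using pos by (simp add: ennreal_mult_less_top)
  finally have "(\<integral>\<^sup>+x. \<integral>\<^sup>+y. ennreal (\<bar>x - y\<bar> powr \<alpha>) \<partial>\<mu> \<partial>\<mu>) \<noteq> \<infinity>" by simp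
  hence ae: "AE x in \<mu>. (\<integral>\<^sup>+y. ennreal (\<bar>x - y\<bar> powr \<alpha>) \<partial>\<mu>) \<noteq> \<infinity>"
    by (intro nn_integral_PInf_AE) auto
  then obtain x where x: "(\<integral>\<^sup>+y. ennreal (\<bar>x - y\<bar> powr \<alpha>) \<partial>\<mu>) \<noteq> \<infinity>"
    using eventually_happens'[OF M.ae_filter_bot ae] by blast
  have "integrable \<mu> (\<lambda>y. \<bar>x - y\<bar> powr \<alpha>)"
    by (rule integrableI_nonneg) (use x in \<open>auto simp: less_top[symmetric]\<close>)
  hence "integrable \<mu> (\<lambda>y. 2 powr \<alpha> * (\<bar>x\<bar> powr \<alpha> + \<bar>x - y\<bar> powr \<alpha>))" by auto
  hence "integrable \<mu> (\<lambda>y. \<bar>y\<bar> powr \<alpha>)"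
    by (rule Bochner_Integration.integrable_bound)
       (use abs_diff_powr_le[of \<alpha> x "x - y" for y] \<beta> in auto)
  thus ?thesis using \<mu> by (simp add: finite_moment_def)
qed

lemma translate_prob_measures:
  fixes \<mu> :: "real measure"
  assumes "\<mu> \<in> prob_measures"
  shows "translate a \<mu> \<in> prob_measures"
  using assms unfolding prob_measures_def translate_def
  by (auto intro!: prob_space.prob_space_distr cong: measurable_cong_sets)

lemma energy_translate:
  fixes \<mu> :: "real measure"
  assumes "\<mu> \<in> prob_measures"
  shows "energy \<alpha> \<beta> (translate a \<mu>) = energy \<alpha> \<beta> \<mu>"
proof -
  have [measurable_cong]: "sets \<mu> = sets borel" using assms by (simp add: prob_measures_def)
  interpret M: prob_space \<mu> using assms by (simp add: prob_measures_def)
  have "prob_space (translate a \<mu>)"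
    using translate_prob_measures[OF assms] by (simp add: prob_measures_def)
  hence "sigma_finite_measure (distr \<mu> borel (\<lambda>x. x + a))"
    unfolding translate_def by (rule prob_space_imp_sigma_finite)
  hence *: "translate a \<mu> \<Otimes>\<^sub>M translate a \<mu>
      = distr (\<mu> \<Otimes>\<^sub>M \<mu>) (borel \<Otimes>\<^sub>M borel) (\<lambda>(x, y). (x + a, y + a))"
    unfolding translate_def by (intro pair_measure_distr) auto
  have [measurable]: "(kernel \<alpha> \<beta> :: real \<times> real \<Rightarrow> real) \<in> borel_measurable (borel \<Otimes>\<^sub>M borel)"
    unfolding kernel_def by measurable
  have "(\<integral>\<^sup>+z. ennreal (c * kernel \<alpha> \<beta> z) \<partial>(translate a \<mu> \<Otimes>\<^sub>M translate a \<mu>))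
      = (\<integral>\<^sup>+z. ennreal (c * kernel \<alpha> \<beta> z) \<partial>(\<mu> \<Otimes>\<^sub>M \<mu>))" for c
    unfolding * by (subst nn_integral_distr) (auto intro!: nn_integral_cong simp: kernel_def)
  from this[of 1] this[of "-1"] show ?thesis unfolding energy_def by simp
qed

lemma mean_translate:
  fixes \<mu> :: "real measure"
  assumes "\<mu> \<in> prob_measures" "integrable \<mu> (\<lambda>x. x)"
  shows "(\<integral>x. x \<partial>translate a \<mu>) = (\<integral>x. x \<partial>\<mu>) + a"
proof -
  have [measurable_cong]: "sets \<mu> = sets borel" using assms by (simp add: prob_measures_def)
  interpret M: prob_space \<mu> using assms by (simp add: prob_measures_def)
  have "(\<integral>x. x \<partial>translate a \<mu>) = (\<integral>x. x + a \<partial>\<mu>)"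
    unfolding translate_def by (rule integral_distr) measurable
  also have "\<dots> = (\<integral>x. x \<partial>\<mu>) + a"
    using assms(2) M.prob_space by simp
  finally show ?thesis .
qed

section \<open>The energy gap above Frank's measure\<close>

definition char_distance :: "real \<Rightarrow> real measure \<Rightarrow> real" where
  "char_distance \<alpha> \<eta> = (\<integral>k. fourier_weight \<alpha> k * (cmod (char \<eta> k - char (frank_measure \<alpha>) k))\<^sup>2 \<partial>lborel)"

context
  fixes \<alpha> :: real
  assumes \<alpha>: "2 < \<alpha>" "\<alpha> < 3"
begin

lemma frank_measure_finite_moment: "frank_measure \<alpha> \<in> finite_moment \<alpha>"
  using prob_space_frank_measure[OF \<alpha>] \<alpha>
  by (auto simp: finite_moment_def prob_measures_def
      intro!: integrable_frank_measure[OF \<alpha>] continuous_on_abs_powr continuous_intros)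

lemma mean_frank_measure: "(\<integral>x. x \<partial>frank_measure \<alpha>) = 0"
  using integral_frank_uminus[of "\<lambda>x. x" \<alpha>] by simp

lemma energy_real_frank:
  assumes \<eta>: "\<eta> \<in> finite_moment \<alpha>"
  shows "energy_real \<alpha> 2 \<eta> (frank_measure \<alpha>) = (\<integral>x. frank_potential \<alpha> x \<partial>\<eta>)"
    and "integrable \<eta> (frank_potential \<alpha>)"
proof -
  interpret M: real_distribution \<eta> using \<eta> by (rule finite_momentD)
  interpret N: real_distribution "frank_measure \<alpha>"
    using frank_measure_finite_moment by (rule finite_momentD)
  interpret P: pair_prob_space \<eta> "frank_measure \<alpha>"
    by (intro pair_prob_spaceI M.prob_space_axioms N.prob_space_axioms)
  have int: "integrable (\<eta> \<Otimes>\<^sub>M frank_measure \<alpha>) (\<lambda>z. \<bar>fst z - snd z\<bar> powr p)"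
    if "0 < p" "p \<le> \<alpha>" for p
    by (rule integrable_powr_energy[OF \<eta> frank_measure_finite_moment that])
  note int = int[of \<alpha>] int[of 2]
  define f where "f = (\<lambda>z. \<bar>fst z - snd z\<bar> powr \<alpha> / \<alpha> - (fst z - snd z)\<^sup>2 / 2)"
  have fi: "integrable (\<eta> \<Otimes>\<^sub>M frank_measure \<alpha>) f" using int \<alpha> by (simp add: f_def)
  have "energy_real \<alpha> 2 \<eta> (frank_measure \<alpha>) = (\<integral>z. f z \<partial>(\<eta> \<Otimes>\<^sub>M frank_measure \<alpha>))"
    unfolding energy_real_def powr_energy_def f_def using int \<alpha> by simp
  also have "\<dots> = (\<integral>x. \<integral>y. f (x, y) \<partial>frank_measure \<alpha> \<partial>\<eta>)"
    by (rule P.integral_fst'[OF fi, symmetric])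
  also have "\<dots> = (\<integral>x. frank_potential \<alpha> x \<partial>\<eta>)"
    by (simp add: f_def frank_potential_def)
  finally show "energy_real \<alpha> 2 \<eta> (frank_measure \<alpha>) = (\<integral>x. frank_potential \<alpha> x \<partial>\<eta>)" .
  show "integrable \<eta> (frank_potential \<alpha>)"
    using P.integrable_fst'[OF fi] by (simp add: f_def frank_potential_def[abs_def])
qed

text \<open>The linear term of the energy excess: Frank's potential attains its minimum almost everywhere on
Frank's measure.\<close>

lemma energy_real_frank_le:
  assumes \<eta>: "\<eta> \<in> finite_moment \<alpha>"
  shows "energy_real \<alpha> 2 (frank_measure \<alpha>) (frank_measure \<alpha>) \<le> energy_real \<alpha> 2 \<eta> (frank_measure \<alpha>)"
proof -
  interpret M: real_distribution \<eta> using \<eta> by (rule finite_momentD)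
  interpret N: real_distribution "frank_measure \<alpha>"
    using frank_measure_finite_moment by (rule finite_momentD)
  have "energy_real \<alpha> 2 (frank_measure \<alpha>) (frank_measure \<alpha>)
      = (\<integral>x. frank_potential \<alpha> x \<partial>frank_measure \<alpha>)"
    by (rule energy_real_frank[OF frank_measure_finite_moment])
  also have "\<dots> = (\<integral>x. frank_potential \<alpha> 0 \<partial>frank_measure \<alpha>)"
  proof (rule integral_cong_AE)
    show "AE x in frank_measure \<alpha>. frank_potential \<alpha> x = frank_potential \<alpha> 0"
      using AE_frank_measure[OF \<alpha>] by eventually_elim (rule frank_potential_eq[OF \<alpha>])
  qed (use energy_real_frank(2)[OF frank_measure_finite_moment] in auto)
  also have "\<dots> = (\<integral>x. frank_potential \<alpha> 0 \<partial>\<eta>)"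
    using M.prob_space N.prob_space by simp
  also have "\<dots> \<le> (\<integral>x. frank_potential \<alpha> x \<partial>\<eta>)"
    using energy_real_frank(2)[OF \<eta>] by (intro integral_mono frank_potential_ge[OF \<alpha>]) auto
  also have "\<dots> = energy_real \<alpha> 2 \<eta> (frank_measure \<alpha>)"
    by (rule energy_real_frank(1)[OF \<eta>, symmetric])
  finally show ?thesis .
qed

text \<open>The excess energy is the difference of the two means of Frank's potential plus half the second
difference of the energy.  In the latter the quadratic parts cancel for centred measures, leaving
the distance of the characteristic functions.\<close>

lemma energy_gap:
  assumes \<eta>: "\<eta> \<in> finite_moment \<alpha>" "(\<integral>x. x \<partial>\<eta>) = 0"
  shows "char_distance \<alpha> \<eta> \<le> fourier_const \<alpha> * \<alpha>
    * (energy_real \<alpha> 2 \<eta> \<eta> - energy_real \<alpha> 2 (frank_measure \<alpha>) (frank_measure \<alpha>))"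
proof -
  let ?F = "frank_measure \<alpha>"
  note F = frank_measure_finite_moment mean_frank_measure
  have two: "2 \<le> \<alpha>" using \<alpha> by simp
  \<comment> \<open>centring makes the quadratic part affine, so it has no second difference\<close>
  have "powr_energy 2 \<eta> \<eta> + powr_energy 2 ?F ?F - 2 * powr_energy 2 \<eta> ?F = 0"
    unfolding powr_energy_two[OF \<eta> \<eta> two] powr_energy_two[OF F F two] powr_energy_two[OF \<eta> F two]
    by simp
  moreover have "\<alpha> * (energy_real \<alpha> 2 \<eta> \<eta> + energy_real \<alpha> 2 ?F ?F - 2 * energy_real \<alpha> 2 \<eta> ?F)
      = powr_energy \<alpha> \<eta> \<eta> + powr_energy \<alpha> ?F ?F - 2 * powr_energy \<alpha> \<eta> ?F
        - \<alpha> / 2 * (powr_energy 2 \<eta> \<eta> + powr_energy 2 ?F ?F - 2 * powr_energy 2 \<eta> ?F)"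
    using \<alpha> unfolding energy_real_def by (simp add: field_simps)
  ultimately have "\<alpha> * (energy_real \<alpha> 2 \<eta> \<eta> + energy_real \<alpha> 2 ?F ?F - 2 * energy_real \<alpha> 2 \<eta> ?F)
      = powr_energy \<alpha> \<eta> \<eta> + powr_energy \<alpha> ?F ?F - 2 * powr_energy \<alpha> \<eta> ?F"
    by simp
  hence "char_distance \<alpha> \<eta> = fourier_const \<alpha>
      * (\<alpha> * (energy_real \<alpha> 2 \<eta> \<eta> + energy_real \<alpha> 2 ?F ?F - 2 * energy_real \<alpha> 2 \<eta> ?F))"
    unfolding char_distance_def powr_energy_char_diff(2)[OF \<alpha> \<eta> F] by simp
  also have "\<dots> \<le> fourier_const \<alpha> * (\<alpha> * (energy_real \<alpha> 2 \<eta> \<eta> - energy_real \<alpha> 2 ?F ?F))"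
    using energy_real_frank_le[OF \<eta>(1)] fourier_const_pos[OF \<alpha>] \<alpha>
    by (intro mult_left_mono) auto
  finally show ?thesis by (simp add: mult.assoc)
qed

lemma char_distance_nonneg: "0 \<le> char_distance \<alpha> \<eta>"
  unfolding char_distance_def by (intro integral_nonneg_AE AE_I2) simp

text \<open>A competitor of finite energy has a mean and may be centred without changing its energy.\<close>

lemma frank_measure_minimizer: "frank_measure \<alpha> \<in> minimizers \<alpha> 2"
proof -
  have "energy \<alpha> 2 (frank_measure \<alpha>) \<le> energy \<alpha> 2 \<mu>" if \<mu>: "\<mu> \<in> prob_measures" for \<mu> :: "real measure"
  proof (cases "energy \<alpha> 2 \<mu> = \<infinity>")
    case False
    have "\<mu> \<in> finite_moment \<alpha>"
      by (rule finite_moment_of_finite_energy[OF \<mu> _ _ False]) (use \<alpha> in auto)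
    hence int: "integrable \<mu> (\<lambda>x. x)" using integrable_second_moment \<alpha> by auto
    define \<eta> where "\<eta> = translate (- (\<integral>x. x \<partial>\<mu>)) \<mu>"
    have e: "energy \<alpha> 2 \<eta> = energy \<alpha> 2 \<mu>" unfolding \<eta>_def by (rule energy_translate[OF \<mu>])
    have \<eta>: "\<eta> \<in> finite_moment \<alpha>"
    proof (rule finite_moment_of_finite_energy)
      show "\<eta> \<in> prob_measures" unfolding \<eta>_def by (rule translate_prob_measures[OF \<mu>])
      show "energy \<alpha> 2 \<eta> \<noteq> \<infinity>" using e False by simp
    qed (use \<alpha> in auto)
    have "(\<integral>x. x \<partial>\<eta>) = 0" unfolding \<eta>_def using mean_translate[OF \<mu> int] by simp
    from energy_gap[OF \<eta> this] char_distance_nonneg[of \<eta>]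
    have "0 \<le> fourier_const \<alpha> * \<alpha>
        * (energy_real \<alpha> 2 \<eta> \<eta> - energy_real \<alpha> 2 (frank_measure \<alpha>) (frank_measure \<alpha>))" by linarith
    hence "energy_real \<alpha> 2 (frank_measure \<alpha>) (frank_measure \<alpha>) \<le> energy_real \<alpha> 2 \<eta> \<eta>"
      using mult_pos_pos[OF fourier_const_pos[OF \<alpha>], of \<alpha>] \<alpha> by (simp add: zero_le_mult_iff)
    hence "energy \<alpha> 2 (frank_measure \<alpha>) \<le> energy \<alpha> 2 \<eta>"
      using energy_eq_energy_real[OF \<eta>, of 2] energy_eq_energy_real[OF frank_measure_finite_moment, of 2] \<alpha>
      by simp
    thus ?thesis using e by simp
  qed simp
  moreover have "frank_measure \<alpha> \<in> prob_measures"
    using frank_measure_finite_moment by (simp add: finite_moment_def)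
  ultimately show ?thesis by (auto simp: minimizers_def is_arg_min_def not_less)
qed

end

section \<open>Stability in the exponent and convergence\<close>

text \<open>Mean value theorem in the exponent.  The logarithm in the derivative is harmless near zero since the
exponent is at least one, and for large \<open>z\<close> it costs only a factor \<open>z powr ((\<alpha> - 2) / 2)\<close>.\<close>

lemma powr_divide_exponent_lipschitz:
  fixes z b \<alpha> :: real
  assumes \<alpha>: "2 < \<alpha>" "\<alpha> < 3" and z: "0 \<le> z" and b: "\<bar>b - 2\<bar> \<le> (\<alpha> - 2) / 2"
  shows "\<bar>z powr b / b - z powr 2 / 2\<bar> \<le> (2 + 2 / (\<alpha> - 2)) * (1 + z powr \<alpha>) * \<bar>b - 2\<bar>"
proof (cases "z = 0")
  case True
  have "0 \<le> (2 + 2 / (\<alpha> - 2)) * \<bar>b - 2\<bar>" using \<alpha> by auto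
  thus ?thesis using True by simp
next
  case False
  hence z: "0 < z" using z by simp
  define e where "e = (\<alpha> - 2) / 2"
  have e: "0 < e" "e < 1 / 2" using \<alpha> by (auto simp: e_def)
  define f' where "f' = (\<lambda>t. z powr t * ln z / t - z powr t / t\<^sup>2)"
  have deriv: "((\<lambda>t. z powr t / t) has_real_derivative f' t) (at t within {2 - e..2 + e})"
    if "t \<in> {2 - e..2 + e}" for t
  proof -
    have "((\<lambda>t. exp (t * ln z) / t) has_real_derivative f' t) (at t within {2 - e..2 + e})"
      unfolding f'_def using that z e
      by (auto intro!: derivative_eq_intros simp: powr_def field_simps power2_eq_square)
    thus ?thesis using z by (simp add: powr_def)
  qed
  have bound: "norm (f' t) \<le> (2 + 1 / e) * (1 + z powr \<alpha>)" if t: "t \<in> {2 - e..2 + e}" for t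
  proof -
    have t1: "1 \<le> t" using t e by auto
    have "t \<le> 2 + e" using t by simp
    hence ta: "t \<le> \<alpha>" using \<alpha> by (simp add: e_def field_simps)
    have zt: "z powr t \<le> 1 + z powr \<alpha>"
      by (rule powr_le_one_plus_powr) (use z t1 ta in auto)
    have "\<bar>z powr t * ln z\<bar> \<le> (1 + 1 / e) * (1 + z powr \<alpha>)"
    proof (cases "z \<le> 1")
      case True
      have "ln (1 / z) \<le> 1 / z - 1" by (rule ln_le_minus_one) (use z in auto)
      hence "- ln z \<le> 1 / z" using z by (simp add: ln_div)
      hence "z * (- ln z) \<le> 1" using z by (simp add: field_simps)
      moreover have "z powr t * (- ln z) \<le> z powr 1 * (- ln z)"
        using True z t1 by (intro mult_right_mono powr_mono') auto
      moreover have "\<bar>z powr t * ln z\<bar> = z powr t * (- ln z)"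
        using True z by (simp add: abs_mult)
      ultimately have "\<bar>z powr t * ln z\<bar> \<le> 1 * 1" using z by simp
      also have "\<dots> \<le> (1 + 1 / e) * (1 + z powr \<alpha>)" using e by (intro mult_mono) auto
      finally show ?thesis .
    next
      case False
      have "\<bar>z powr t * ln z\<bar> = z powr t * ln z" using False by (simp add: abs_mult)
      also have "\<dots> \<le> z powr (2 + e) * (z powr e / e)"
        using False t e by (intro mult_mono powr_mono ln_powr_bound) auto
      also have "\<dots> = z powr (2 + e + e) / e"
        by (simp only: powr_add[of z "2 + e" e] times_divide_eq_right)
      also have "2 + e + e = \<alpha>" by (simp add: e_def)
      also have "z powr \<alpha> / e \<le> (1 + 1 / e) * (1 + z powr \<alpha>)" using e by (simp add: field_simps)
      finally show ?thesis .
    qed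
    moreover have "\<bar>z powr t * ln z / t\<bar> \<le> \<bar>z powr t * ln z\<bar>"
      using t1 mult_left_mono[of 1 t "\<bar>z powr t * ln z\<bar>"] by (simp add: abs_divide pos_divide_le_eq)
    moreover have "z powr t / t\<^sup>2 \<le> z powr t"
      using t1 mult_left_mono[of 1 "t\<^sup>2" "z powr t"] by (simp add: pos_divide_le_eq)
    moreover have "0 \<le> z powr t / t\<^sup>2" by simp
    ultimately have "norm (f' t) \<le> (1 + 1 / e) * (1 + z powr \<alpha>) + (1 + z powr \<alpha>)"
      unfolding f'_def real_norm_def using zt by linarith
    thus ?thesis by (simp add: algebra_simps)
  qed
  have "b - 2 \<le> e" "- (b - 2) \<le> e" using b unfolding e_def abs_le_iff by blast+
  hence b': "b \<in> {2 - e..2 + e}" by simp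
  have "norm (z powr b / b - z powr 2 / 2) \<le> (2 + 1 / e) * (1 + z powr \<alpha>) * norm (b - 2)"
    by (rule field_differentiable_bound[of "{2 - e..2 + e}" "\<lambda>t. z powr t / t" f', OF _ deriv bound])
       (use b' e in auto)
  thus ?thesis by (simp add: e_def)
qed

lemma char_lipschitz:
  assumes "real_distribution \<mu>" and int: "integrable \<mu> (\<lambda>x. x)"
  shows "cmod (char \<mu> s - char \<mu> t) \<le> \<bar>s - t\<bar> * (\<integral>x. \<bar>x\<bar> \<partial>\<mu>)"
proof -
  interpret real_distribution \<mu> by fact
  have "cmod (char \<mu> s - char \<mu> t) = cmod (\<integral>x. iexp (s * x) - iexp (t * x) \<partial>\<mu>)"
    unfolding char_def by (subst Bochner_Integration.integral_diff) (auto intro: integrable_iexp)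
  also have "\<dots> \<le> (\<integral>x. \<bar>s - t\<bar> * \<bar>x\<bar> \<partial>\<mu>)"
  proof (rule Bochner_Integration.integral_norm_bound_integral)
    show "integrable \<mu> (\<lambda>x. iexp (s * x) - iexp (t * x))"
      by (intro Bochner_Integration.integrable_diff integrable_iexp) auto
    show "integrable \<mu> (\<lambda>x. \<bar>s - t\<bar> * \<bar>x\<bar>)" using int by auto
    fix x
    have "iexp (s * x) - iexp (t * x) = iexp (t * x) * (iexp ((s - t) * x) - 1)"
      by (simp add: algebra_simps flip: exp_add)
    hence "cmod (iexp (s * x) - iexp (t * x)) = cmod (iexp ((s - t) * x) - 1)"
      by (simp only: norm_mult norm_exp_i_times mult_1)
    also have "\<dots> \<le> \<bar>(s - t) * x\<bar>" using iexp_approx1[of "(s - t) * x" 0] by simp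
    finally show "norm (iexp (s * x) - iexp (t * x)) \<le> \<bar>s - t\<bar> * \<bar>x\<bar>" by (simp add: abs_mult)
  qed
  finally show ?thesis by simp
qed

text \<open>For a centred measure \<open>\<bar>x\<bar>\<close> is the modulus of the mean of \<open>x - y\<close> over \<open>y\<close>.\<close>

lemma first_moment_le_powr_energy:
  assumes \<mu>: "\<mu> \<in> finite_moment \<alpha>" "(\<integral>x. x \<partial>\<mu>) = 0" and \<alpha>: "2 \<le> \<alpha>"
  shows "(\<integral>x. \<bar>x\<bar> \<partial>\<mu>) \<le> 1 + powr_energy \<alpha> \<mu> \<mu>"
proof -
  interpret M: real_distribution \<mu> using \<mu>(1) by (rule finite_momentD)
  interpret P: pair_prob_space \<mu> \<mu> by (intro pair_prob_spaceI M.prob_space_axioms)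
  note int = integrable_second_moment[OF \<mu>(1) \<alpha>]
  have i1: "integrable (\<mu> \<Otimes>\<^sub>M \<mu>) (\<lambda>z. \<bar>fst z - snd z\<bar>)"
    using integrable_powr_energy[OF \<mu>(1) \<mu>(1), of 1] \<alpha> by simp
  have ia: "integrable (\<mu> \<Otimes>\<^sub>M \<mu>) (\<lambda>z. \<bar>fst z - snd z\<bar> powr \<alpha>)"
    using integrable_powr_energy[OF \<mu>(1) \<mu>(1), of \<alpha>] \<alpha> by simp
  have "(\<integral>x. \<bar>x\<bar> \<partial>\<mu>) \<le> (\<integral>x. \<integral>y. \<bar>x - y\<bar> \<partial>\<mu> \<partial>\<mu>)"
  proof (rule integral_mono)
    show "integrable \<mu> (\<lambda>x. \<integral>y. \<bar>x - y\<bar> \<partial>\<mu>)" using P.integrable_fst'[OF i1] by simp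
    fix x
    have "\<bar>x\<bar> = \<bar>\<integral>y. x - y \<partial>\<mu>\<bar>" using int \<mu>(2) M.prob_space by simp
    also have "\<dots> \<le> (\<integral>y. \<bar>x - y\<bar> \<partial>\<mu>)" by (rule integral_abs_bound)
    finally show "\<bar>x\<bar> \<le> (\<integral>y. \<bar>x - y\<bar> \<partial>\<mu>)" .
  qed (use int in auto)
  also have "\<dots> = (\<integral>z. \<bar>fst z - snd z\<bar> \<partial>(\<mu> \<Otimes>\<^sub>M \<mu>))"
    using P.integral_fst'[OF i1] by simp
  also have "\<dots> \<le> (\<integral>z. 1 + \<bar>fst z - snd z\<bar> powr \<alpha> \<partial>(\<mu> \<Otimes>\<^sub>M \<mu>))"
  proof (rule integral_mono[OF i1])
    fix z :: "real \<times> real"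
    show "\<bar>fst z - snd z\<bar> \<le> 1 + \<bar>fst z - snd z\<bar> powr \<alpha>"
      using powr_le_one_plus_powr[of "\<bar>fst z - snd z\<bar>" 1 \<alpha>] \<alpha> by simp
  qed (use ia in auto)
  also have "\<dots> = 1 + powr_energy \<alpha> \<mu> \<mu>"
    unfolding powr_energy_def using ia P.prob_space by simp
  finally show ?thesis .
qed

text \<open>A Lipschitz function that is at least \<open>\<epsilon>\<close> at one point is at least \<open>\<epsilon> / 2\<close> on an interval
whose length depends on \<open>\<epsilon>\<close> and the Lipschitz constant alone.\<close>

lemma weighted_L2_imp_pointwise:
  fixes d :: "nat \<Rightarrow> real \<Rightarrow> real"
  assumes nonneg: "\<And>m k. 0 \<le> d m k"
    and lip: "\<forall>\<^sub>F m in sequentially. \<forall>s t. \<bar>d m s - d m t\<bar> \<le> L * \<bar>s - t\<bar>"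
    and int: "\<forall>\<^sub>F m in sequentially. integrable lborel (\<lambda>k. fourier_weight \<alpha> k * (d m k)\<^sup>2)"
    and lim: "(\<lambda>m. \<integral>k. fourier_weight \<alpha> k * (d m k)\<^sup>2 \<partial>lborel) \<longlonglongrightarrow> 0"
    and k: "0 < k" and \<alpha>: "0 < \<alpha>"
  shows "(\<lambda>m. d m k) \<longlonglongrightarrow> 0"
proof (rule order_tendstoI)
  fix \<epsilon> :: real assume \<epsilon>: "0 < \<epsilon>"
  define L' where "L' = max L 1"
  \<comment> \<open>on \<open>{k..k + h}\<close> the function changes by at most \<open>\<epsilon> / 2\<close>\<close>
  define h where "h = \<epsilon> / (2 * L')"
  have L': "0 < L'" "L \<le> L'" by (auto simp: L'_def)
  have h: "0 < h" "L' * h = \<epsilon> / 2" using \<epsilon> L' by (auto simp: h_def)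
  define c where "c = (k + h) powr (- 1 - \<alpha>) * (\<epsilon> / 2)\<^sup>2"
  have c: "0 < c * h" using k h \<epsilon> by (simp add: c_def)
  have "\<forall>\<^sub>F m in sequentially. (\<integral>k. fourier_weight \<alpha> k * (d m k)\<^sup>2 \<partial>lborel) < c * h"
    by (rule order_tendstoD(2)[OF lim c])
  with lip int show "\<forall>\<^sub>F m in sequentially. d m k < \<epsilon>"
  proof eventually_elim
    case (elim m)
    show "d m k < \<epsilon>"
    proof (rule ccontr)
      assume "\<not> d m k < \<epsilon>"
      hence big: "\<epsilon> \<le> d m k" by simp
      have "c * h = (\<integral>t. indicat_real {k..k + h} t * c \<partial>lborel)" using h by simp
      also have "\<dots> \<le> (\<integral>k. fourier_weight \<alpha> k * (d m k)\<^sup>2 \<partial>lborel)"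
      proof (rule integral_mono)
        show "integrable lborel (\<lambda>t. indicat_real {k..k + h} t * c)"
          by (intro integrable_mult_left integrable_real_indicator) (auto simp: emeasure_lborel_Icc_eq)
        fix t
        show "indicat_real {k..k + h} t * c \<le> fourier_weight \<alpha> t * (d m t)\<^sup>2"
        proof (cases "t \<in> {k..k + h}")
          case True
          have "\<bar>d m k - d m t\<bar> \<le> L * \<bar>k - t\<bar>" using elim(1) by blast
          also have "\<dots> \<le> L' * h" using True L' by (intro mult_mono) auto
          finally have "\<epsilon> / 2 \<le> d m t" using big h by linarith
          hence "(\<epsilon> / 2)\<^sup>2 \<le> (d m t)\<^sup>2" using \<epsilon> by (intro power_mono) auto
          moreover have "(k + h) powr (- 1 - \<alpha>) \<le> t powr (- 1 - \<alpha>)"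
            using True k \<alpha> by (intro powr_mono2') auto
          ultimately have "c \<le> t powr (- 1 - \<alpha>) * (d m t)\<^sup>2"
            unfolding c_def by (intro mult_mono) auto
          thus ?thesis using True k by (simp add: fourier_weight_def)
        qed simp
      qed (use elim(2) in auto)
      finally show False using elim(3) by simp
    qed
  qed
next
  fix a :: real assume "a < 0"
  thus "\<forall>\<^sub>F m in sequentially. a < d m k"
    by (intro always_eventually allI less_le_trans[OF _ nonneg])
qed

context
  fixes \<alpha> :: real
  assumes \<alpha>: "2 < \<alpha>" "\<alpha> < 3"
begin

lemma exponent_near_two:
  assumes "\<bar>b - 2\<bar> \<le> (\<alpha> - 2) / 2"
  shows "1 \<le> b" "b \<le> (2 + \<alpha>) / 2"
proof -
  have "b - 2 \<le> (\<alpha> - 2) / 2" "- (b - 2) \<le> (\<alpha> - 2) / 2"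
    using assms unfolding abs_le_iff by blast+
  thus "1 \<le> b" "b \<le> (2 + \<alpha>) / 2" using \<alpha> by (simp_all add: field_simps)
qed

text \<open>The attractive part \<open>\<bar>x - y\<bar> powr \<alpha>\<close> dominates the repulsive part uniformly for exponents
\<open>\<beta>\<close> in a closed interval below \<open>\<alpha>\<close>.\<close>

lemma low_energy_moment_bound:
  obtains B where "\<And>\<beta> \<eta>. \<lbrakk>\<bar>\<beta> - 2\<bar> \<le> (\<alpha> - 2) / 2; \<eta> \<in> finite_moment \<alpha>;
      energy_real \<alpha> \<beta> \<eta> \<eta> \<le> energy_real \<alpha> \<beta> (frank_measure \<alpha>) (frank_measure \<alpha>)\<rbrakk>
    \<Longrightarrow> powr_energy \<alpha> \<eta> \<eta> \<le> B"
proof -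
  let ?F = "frank_measure \<alpha>"
  define b where "b = (2 + \<alpha>) / 2"
  obtain C where C: "0 \<le> C" "\<And>z. 0 \<le> z \<Longrightarrow> z powr b \<le> 1 / (2 * \<alpha>) * z powr \<alpha> + C"
    using powr_absorb[of b \<alpha> "1 / (2 * \<alpha>)"] \<alpha> by (auto simp: b_def)
  show ?thesis
  proof (rule that[of "2 * \<alpha> * (1 + C) + 2 * powr_energy \<alpha> ?F ?F"])
    fix \<beta> \<eta>
    assume \<beta>: "\<bar>\<beta> - 2\<bar> \<le> (\<alpha> - 2) / 2" and \<eta>: "\<eta> \<in> finite_moment \<alpha>"
      and le: "energy_real \<alpha> \<beta> \<eta> \<eta> \<le> energy_real \<alpha> \<beta> ?F ?F"
    interpret M: real_distribution \<eta> using \<eta> by (rule finite_momentD)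
    interpret P: pair_prob_space \<eta> \<eta> by (intro pair_prob_spaceI M.prob_space_axioms)
    have \<beta>': "1 \<le> \<beta>" "\<beta> \<le> b" "b \<le> \<alpha>"
      using exponent_near_two[OF \<beta>] \<alpha> by (auto simp: b_def)
    have int: "integrable (\<eta> \<Otimes>\<^sub>M \<eta>) (\<lambda>z. \<bar>fst z - snd z\<bar> powr \<alpha>)"
      "integrable (\<eta> \<Otimes>\<^sub>M \<eta>) (\<lambda>z. \<bar>fst z - snd z\<bar> powr \<beta>)"
      using integrable_powr_energy[OF \<eta> \<eta>] \<beta>' by auto
    have "powr_energy \<beta> \<eta> \<eta> \<le> (\<integral>z. (1 + C) + 1 / (2 * \<alpha>) * \<bar>fst z - snd z\<bar> powr \<alpha> \<partial>(\<eta> \<Otimes>\<^sub>M \<eta>))"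
      unfolding powr_energy_def
    proof (rule integral_mono)
      fix z :: "real \<times> real"
      show "\<bar>fst z - snd z\<bar> powr \<beta> \<le> (1 + C) + 1 / (2 * \<alpha>) * \<bar>fst z - snd z\<bar> powr \<alpha>"
        using powr_le_one_plus_powr[of "\<bar>fst z - snd z\<bar>" \<beta> b] C(2)[of "\<bar>fst z - snd z\<bar>"] \<beta>' by simp
    qed (use int in auto)
    also have "\<dots> = 1 + C + powr_energy \<alpha> \<eta> \<eta> / (2 * \<alpha>)"
      unfolding powr_energy_def using int P.prob_space by simp
    finally have 1: "powr_energy \<beta> \<eta> \<eta> \<le> 1 + C + powr_energy \<alpha> \<eta> \<eta> / (2 * \<alpha>)" .
    have nn: "0 \<le> powr_energy \<beta> \<mu> \<mu>" for \<mu>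
      unfolding powr_energy_def by (intro integral_nonneg_AE AE_I2) simp
    have "powr_energy \<beta> \<eta> \<eta> / \<beta> \<le> powr_energy \<beta> \<eta> \<eta>"
      using \<beta>' mult_left_mono[OF \<beta>'(1) nn[of \<eta>]] by (simp add: pos_divide_le_eq)
    moreover have "0 \<le> powr_energy \<beta> ?F ?F / \<beta>" using nn \<beta>' by simp
    ultimately have "powr_energy \<alpha> \<eta> \<eta> / \<alpha> - (1 + C + powr_energy \<alpha> \<eta> \<eta> / (2 * \<alpha>))
        \<le> powr_energy \<alpha> ?F ?F / \<alpha>"
      using le 1 unfolding energy_real_def by linarith
    moreover have "powr_energy \<alpha> \<eta> \<eta> / \<alpha> = 2 * (powr_energy \<alpha> \<eta> \<eta> / (2 * \<alpha>))" by simp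
    ultimately have "powr_energy \<alpha> \<eta> \<eta> / (2 * \<alpha>) \<le> 1 + C + powr_energy \<alpha> ?F ?F / \<alpha>" by linarith
    hence "2 * \<alpha> * (powr_energy \<alpha> \<eta> \<eta> / (2 * \<alpha>)) \<le> 2 * \<alpha> * (1 + C + powr_energy \<alpha> ?F ?F / \<alpha>)"
      using \<alpha> by (intro mult_left_mono) auto
    thus "powr_energy \<alpha> \<eta> \<eta> \<le> 2 * \<alpha> * (1 + C) + 2 * powr_energy \<alpha> ?F ?F"
      using \<alpha> by (simp add: distrib_left)
  qed
qed

lemma energy_real_exponent_lipschitz:
  assumes \<beta>: "\<bar>\<beta> - 2\<bar> \<le> (\<alpha> - 2) / 2" and \<eta>: "\<eta> \<in> finite_moment \<alpha>"
  shows "\<bar>energy_real \<alpha> \<beta> \<eta> \<eta> - energy_real \<alpha> 2 \<eta> \<eta>\<bar>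
    \<le> (2 + 2 / (\<alpha> - 2)) * (1 + powr_energy \<alpha> \<eta> \<eta>) * \<bar>\<beta> - 2\<bar>"
proof -
  interpret M: real_distribution \<eta> using \<eta> by (rule finite_momentD)
  interpret P: pair_prob_space \<eta> \<eta> by (intro pair_prob_spaceI M.prob_space_axioms)
  have \<beta>': "1 \<le> \<beta>" "\<beta> \<le> \<alpha>" using exponent_near_two[OF \<beta>] \<alpha> by auto
  note int = integrable_powr_energy[OF \<eta> \<eta>]
  have ia: "integrable (\<eta> \<Otimes>\<^sub>M \<eta>) (\<lambda>z. \<bar>fst z - snd z\<bar> powr \<alpha>)" by (rule int) (use \<alpha> in auto)
  have ib: "integrable (\<eta> \<Otimes>\<^sub>M \<eta>) (\<lambda>z. \<bar>fst z - snd z\<bar> powr \<beta>)" by (rule int) (use \<beta>' in auto)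
  have i2: "integrable (\<eta> \<Otimes>\<^sub>M \<eta>) (\<lambda>z. \<bar>fst z - snd z\<bar> powr 2)" by (rule int) (use \<alpha> in auto)
  define C where "C = (2 + 2 / (\<alpha> - 2))"
  have "\<bar>energy_real \<alpha> \<beta> \<eta> \<eta> - energy_real \<alpha> 2 \<eta> \<eta>\<bar>
      = \<bar>powr_energy \<beta> \<eta> \<eta> / \<beta> - powr_energy 2 \<eta> \<eta> / 2\<bar>"
    by (simp add: energy_real_def abs_minus_commute)
  also have "\<dots> = \<bar>\<integral>z. \<bar>fst z - snd z\<bar> powr \<beta> / \<beta> - \<bar>fst z - snd z\<bar> powr 2 / 2 \<partial>(\<eta> \<Otimes>\<^sub>M \<eta>)\<bar>"
    unfolding powr_energy_def
    by (subst Bochner_Integration.integral_diff[OF integrable_divide[OF ib] integrable_divide[OF i2]])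
       (simp only: integral_divide_zero)
  also have "\<dots> \<le> (\<integral>z. C * (1 + \<bar>fst z - snd z\<bar> powr \<alpha>) * \<bar>\<beta> - 2\<bar> \<partial>(\<eta> \<Otimes>\<^sub>M \<eta>))"
    unfolding real_norm_def[symmetric]
  proof (rule Bochner_Integration.integral_norm_bound_integral)
    fix z :: "real \<times> real"
    show "norm (norm (fst z - snd z) powr \<beta> / \<beta> - norm (fst z - snd z) powr 2 / 2)
        \<le> C * (1 + norm (fst z - snd z) powr \<alpha>) * norm (\<beta> - 2)"
      unfolding real_norm_def C_def by (rule powr_divide_exponent_lipschitz[OF \<alpha> _ \<beta>]) simp
  next
    show "integrable (\<eta> \<Otimes>\<^sub>M \<eta>)
        (\<lambda>z. norm (fst z - snd z) powr \<beta> / \<beta> - norm (fst z - snd z) powr 2 / 2)"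
      unfolding real_norm_def
      by (intro Bochner_Integration.integrable_diff integrable_divide ib i2)
    show "integrable (\<eta> \<Otimes>\<^sub>M \<eta>) (\<lambda>z. C * (1 + norm (fst z - snd z) powr \<alpha>) * norm (\<beta> - 2))"
      unfolding real_norm_def using ia by simp
  qed
  also have "\<dots> = C * (1 + powr_energy \<alpha> \<eta> \<eta>) * \<bar>\<beta> - 2\<bar>"
    unfolding powr_energy_def using ia P.prob_space by simp
  finally show ?thesis unfolding C_def .
qed

text \<open>The comparison with Frank's measure takes place at the exponent \<open>\<beta>\<close>, the energy gap at the
exponent \<open>2\<close>; passing between the two costs a multiple of \<open>\<bar>\<beta> - 2\<bar>\<close> for each measure.\<close>

lemma char_distance_low_energy:
  obtains K B where "\<And>\<beta> \<eta>. \<lbrakk>\<bar>\<beta> - 2\<bar> \<le> (\<alpha> - 2) / 2; \<eta> \<in> finite_moment \<alpha>; (\<integral>x. x \<partial>\<eta>) = 0;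
      energy_real \<alpha> \<beta> \<eta> \<eta> \<le> energy_real \<alpha> \<beta> (frank_measure \<alpha>) (frank_measure \<alpha>)\<rbrakk>
    \<Longrightarrow> powr_energy \<alpha> \<eta> \<eta> \<le> B \<and> char_distance \<alpha> \<eta> \<le> K * \<bar>\<beta> - 2\<bar>"
proof -
  let ?F = "frank_measure \<alpha>"
  obtain B where B: "\<And>\<beta> \<eta>. \<lbrakk>\<bar>\<beta> - 2\<bar> \<le> (\<alpha> - 2) / 2; \<eta> \<in> finite_moment \<alpha>;
      energy_real \<alpha> \<beta> \<eta> \<eta> \<le> energy_real \<alpha> \<beta> ?F ?F\<rbrakk> \<Longrightarrow> powr_energy \<alpha> \<eta> \<eta> \<le> B"
    using low_energy_moment_bound by blast
  define C where "C = 2 + 2 / (\<alpha> - 2)"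
  have C: "0 \<le> C" using \<alpha> by (simp add: C_def)
  define K where "K = fourier_const \<alpha> * \<alpha> * (C * (1 + B) + C * (1 + powr_energy \<alpha> ?F ?F))"
  show ?thesis
  proof (rule that[of B K], intro conjI)
    fix \<beta> \<eta>
    assume \<beta>: "\<bar>\<beta> - 2\<bar> \<le> (\<alpha> - 2) / 2" and \<eta>: "\<eta> \<in> finite_moment \<alpha>" "(\<integral>x. x \<partial>\<eta>) = 0"
      and le: "energy_real \<alpha> \<beta> \<eta> \<eta> \<le> energy_real \<alpha> \<beta> ?F ?F"
    show bd: "powr_energy \<alpha> \<eta> \<eta> \<le> B" by (rule B[OF \<beta> \<eta>(1) le])
    have "C * (1 + powr_energy \<alpha> \<eta> \<eta>) * \<bar>\<beta> - 2\<bar> \<le> C * (1 + B) * \<bar>\<beta> - 2\<bar>"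
      using bd C by (intro mult_right_mono mult_left_mono) auto
    hence "energy_real \<alpha> 2 \<eta> \<eta> - energy_real \<alpha> 2 ?F ?F
        \<le> C * (1 + B) * \<bar>\<beta> - 2\<bar> + C * (1 + powr_energy \<alpha> ?F ?F) * \<bar>\<beta> - 2\<bar>"
      using energy_real_exponent_lipschitz[OF \<beta> \<eta>(1)] le
        energy_real_exponent_lipschitz[OF \<beta> frank_measure_finite_moment[OF \<alpha>]]
      unfolding C_def[symmetric] by linarith
    also have "\<dots> = (C * (1 + B) + C * (1 + powr_energy \<alpha> ?F ?F)) * \<bar>\<beta> - 2\<bar>"
      by (simp add: algebra_simps)
    finally have "fourier_const \<alpha> * \<alpha> * (energy_real \<alpha> 2 \<eta> \<eta> - energy_real \<alpha> 2 ?F ?F)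
        \<le> fourier_const \<alpha> * \<alpha> * ((C * (1 + B) + C * (1 + powr_energy \<alpha> ?F ?F)) * \<bar>\<beta> - 2\<bar>)"
      using fourier_const_pos[OF \<alpha>] \<alpha> by (intro mult_left_mono) auto
    thus "char_distance \<alpha> \<eta> \<le> K * \<bar>\<beta> - 2\<bar>"
      using energy_gap[OF \<alpha> \<eta>] unfolding K_def by (simp add: mult.assoc)
  qed
qed

lemma centred_minimizer:
  fixes \<mu> :: "real measure"
  assumes \<beta>: "\<beta> \<in> {1<..<\<alpha>}" and \<mu>: "\<mu> \<in> minimizers \<alpha> \<beta>"
  defines "\<eta> \<equiv> translate (- (\<integral>x. x \<partial>\<mu>)) \<mu>"
  shows "\<eta> \<in> finite_moment \<alpha>" "(\<integral>x. x \<partial>\<eta>) = 0"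
    "energy_real \<alpha> \<beta> \<eta> \<eta> \<le> energy_real \<alpha> \<beta> (frank_measure \<alpha>) (frank_measure \<alpha>)"
proof -
  let ?F = "frank_measure \<alpha>"
  have P: "\<mu> \<in> prob_measures" using \<mu> by (simp add: minimizers_def is_arg_min_def)
  have F: "?F \<in> prob_measures"
    using frank_measure_finite_moment[OF \<alpha>] by (simp add: finite_moment_def)
  have eF: "energy \<alpha> \<beta> ?F = ereal (energy_real \<alpha> \<beta> ?F ?F / 2)"
    by (rule energy_eq_energy_real[OF frank_measure_finite_moment[OF \<alpha>]]) (use \<beta> in auto)
  have le: "energy \<alpha> \<beta> \<mu> \<le> energy \<alpha> \<beta> ?F"
    using \<mu> F by (auto simp: minimizers_def is_arg_min_def not_less)
  hence fin: "energy \<alpha> \<beta> \<mu> \<noteq> \<infinity>" using eF by auto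
  have "\<mu> \<in> finite_moment \<alpha>"
    by (rule finite_moment_of_finite_energy[OF P _ _ fin]) (use \<beta> in auto)
  hence int: "integrable \<mu> (\<lambda>x. x)" using integrable_second_moment \<alpha> by auto
  have e: "energy \<alpha> \<beta> \<eta> = energy \<alpha> \<beta> \<mu>" unfolding \<eta>_def by (rule energy_translate[OF P])
  show \<eta>: "\<eta> \<in> finite_moment \<alpha>"
  proof (rule finite_moment_of_finite_energy)
    show "\<eta> \<in> prob_measures" unfolding \<eta>_def by (rule translate_prob_measures[OF P])
    show "energy \<alpha> \<beta> \<eta> \<noteq> \<infinity>" using e fin by simp
  qed (use \<beta> in auto)
  show "(\<integral>x. x \<partial>\<eta>) = 0" unfolding \<eta>_def using mean_translate[OF P int] by simp
  have "energy \<alpha> \<beta> \<eta> = ereal (energy_real \<alpha> \<beta> \<eta> \<eta> / 2)"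
    by (rule energy_eq_energy_real[OF \<eta>]) (use \<beta> in auto)
  thus "energy_real \<alpha> \<beta> \<eta> \<eta> \<le> energy_real \<alpha> \<beta> ?F ?F" using le e eF by simp
qed

lemma centred_minimizers_char_convergence:
  fixes \<beta> :: "nat \<Rightarrow> real" and \<eta> :: "nat \<Rightarrow> real measure"
  assumes lim: "\<beta> \<longlonglongrightarrow> 2"
    and \<eta>: "\<And>m. \<eta> m \<in> finite_moment \<alpha>" "\<And>m. (\<integral>x. x \<partial>\<eta> m) = 0"
    and le: "\<And>m. energy_real \<alpha> (\<beta> m) (\<eta> m) (\<eta> m) \<le> energy_real \<alpha> (\<beta> m) (frank_measure \<alpha>) (frank_measure \<alpha>)"
  shows "(\<lambda>m. char (\<eta> m) t) \<longlonglongrightarrow> char (frank_measure \<alpha>) t"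
proof -
  let ?F = "frank_measure \<alpha>"
  note F = frank_measure_finite_moment[OF \<alpha>] mean_frank_measure[OF \<alpha>]
  obtain K B where KB: "\<And>\<beta> \<eta>. \<lbrakk>\<bar>\<beta> - 2\<bar> \<le> (\<alpha> - 2) / 2; \<eta> \<in> finite_moment \<alpha>; (\<integral>x. x \<partial>\<eta>) = 0;
      energy_real \<alpha> \<beta> \<eta> \<eta> \<le> energy_real \<alpha> \<beta> ?F ?F\<rbrakk>
    \<Longrightarrow> powr_energy \<alpha> \<eta> \<eta> \<le> B \<and> char_distance \<alpha> \<eta> \<le> K * \<bar>\<beta> - 2\<bar>"
    by (rule char_distance_low_energy) (rule that)
  have lim0: "(\<lambda>m. \<bar>\<beta> m - 2\<bar>) \<longlonglongrightarrow> 0"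
    using lim by (simp add: LIM_zero_iff tendsto_rabs_zero_iff)
  have near: "\<forall>\<^sub>F m in sequentially. \<bar>\<beta> m - 2\<bar> \<le> (\<alpha> - 2) / 2"
    using order_tendstoD(2)[OF lim0, of "(\<alpha> - 2) / 2"] \<alpha> by (auto elim: eventually_mono)
  define d where "d m k = cmod (char (\<eta> m) k - char ?F k)" for m k
  have dist_lim: "(\<lambda>m. \<integral>k. fourier_weight \<alpha> k * (d m k)\<^sup>2 \<partial>lborel) \<longlonglongrightarrow> 0"
  proof (rule Lim_null_comparison)
    show "(\<lambda>m. K * \<bar>\<beta> m - 2\<bar>) \<longlonglongrightarrow> 0" using tendsto_mult_left[OF lim0, of K] by simp
    show "\<forall>\<^sub>F m in sequentially. norm (\<integral>k. fourier_weight \<alpha> k * (d m k)\<^sup>2 \<partial>lborel) \<le> K * \<bar>\<beta> m - 2\<bar>"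
      using near
    proof eventually_elim
      case (elim m)
      show ?case using KB[OF elim \<eta> le] char_distance_nonneg[OF \<alpha>, of "\<eta> m"]
        by (simp add: char_distance_def d_def)
    qed
  qed
  define L where "L = 2 + B + powr_energy \<alpha> ?F ?F"
  have lip: "\<forall>\<^sub>F m in sequentially. \<forall>s t. \<bar>d m s - d m t\<bar> \<le> L * \<bar>s - t\<bar>"
    using near
  proof eventually_elim
    case (elim m)
    have two: "2 \<le> \<alpha>" using \<alpha> by simp
    have M: "(\<integral>x. \<bar>x\<bar> \<partial>\<eta> m) + (\<integral>x. \<bar>x\<bar> \<partial>?F) \<le> L"
      using KB[OF elim \<eta> le] first_moment_le_powr_energy[OF \<eta> two, of m]
        first_moment_le_powr_energy[OF F two] by (simp add: L_def)
    show ?case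
    proof (intro allI)
      fix s t
      have "\<bar>d m s - d m t\<bar> \<le> cmod ((char (\<eta> m) s - char ?F s) - (char (\<eta> m) t - char ?F t))"
        unfolding d_def by (rule norm_triangle_ineq3)
      also have "\<dots> = cmod ((char (\<eta> m) s - char (\<eta> m) t) - (char ?F s - char ?F t))"
        by (simp add: algebra_simps)
      also have "\<dots> \<le> cmod (char (\<eta> m) s - char (\<eta> m) t) + cmod (char ?F s - char ?F t)"
        by (rule norm_triangle_ineq4)
      also have "\<dots> \<le> \<bar>s - t\<bar> * (\<integral>x. \<bar>x\<bar> \<partial>\<eta> m) + \<bar>s - t\<bar> * (\<integral>x. \<bar>x\<bar> \<partial>?F)"
        using \<eta>(1)[of m] F(1) two
        by (intro add_mono char_lipschitz) (auto intro: finite_momentD integrable_second_moment)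
      also have "\<dots> = \<bar>s - t\<bar> * ((\<integral>x. \<bar>x\<bar> \<partial>\<eta> m) + (\<integral>x. \<bar>x\<bar> \<partial>?F))"
        by (simp add: distrib_left)
      also have "\<dots> \<le> \<bar>s - t\<bar> * L" using M by (intro mult_left_mono) auto
      finally show "\<bar>d m s - d m t\<bar> \<le> L * \<bar>s - t\<bar>" by (simp add: mult.commute)
    qed
  qed
  have int: "\<forall>\<^sub>F m in sequentially. integrable lborel (\<lambda>k. fourier_weight \<alpha> k * (d m k)\<^sup>2)"
    unfolding d_def using powr_energy_char_diff(1)[OF \<alpha> \<eta> F] by simp
  have pos: "(\<lambda>m. char (\<eta> m) k) \<longlonglongrightarrow> char ?F k" if k: "0 < k" for k
  proof -
    have "(\<lambda>m. d m k) \<longlonglongrightarrow> 0"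
      by (rule weighted_L2_imp_pointwise[OF _ lip int dist_lim k]) (use \<alpha> in \<open>auto simp: d_def\<close>)
    hence "(\<lambda>m. char (\<eta> m) k - char ?F k) \<longlonglongrightarrow> 0" unfolding d_def by (rule tendsto_norm_zero_cancel)
    thus ?thesis by (simp add: LIM_zero_iff)
  qed
  \<comment> \<open>the weight lives on positive frequencies; the negative ones are their conjugates\<close>
  have minus: "char M (- k) = cnj (char M k)" if "real_distribution M" for M k
    using that by (simp add: char_cos_sin complex_eq_iff)
  consider "t > 0" | "t < 0" | "t = 0" by linarith
  thus ?thesis
  proof cases
    case 2
    hence "(\<lambda>m. cnj (char (\<eta> m) (- t))) \<longlonglongrightarrow> cnj (char ?F (- t))"
      by (intro tendsto_cnj pos) simp
    thus ?thesis using minus[OF finite_momentD(5)[OF \<eta>(1)], of _ "-t"] minus[OF finite_momentD(5)[OF F(1)], of "-t"]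
      by simp
  next
    case 3
    thus ?thesis
      using real_distribution.char_zero[OF finite_momentD(5)[OF \<eta>(1)]]
        real_distribution.char_zero[OF finite_momentD(5)[OF F(1)]] by simp
  qed (rule pos)
qed

end

theorem proposition3p4:
  fixes \<alpha> :: real and \<beta> :: "nat \<Rightarrow> real" and \<mu> :: "nat \<Rightarrow> real measure"
  assumes "\<alpha> \<in> {2<..<3}"
    and "\<And>m. \<beta> m \<in> {1<..<\<alpha>}"
    and "\<beta> \<longlonglongrightarrow> 2"
    and "\<And>m. \<mu> m \<in> minimizers \<alpha> (\<beta> m)"
  shows "\<exists>a :: nat \<Rightarrow> real. \<forall>r :: nat \<Rightarrow> nat. strict_mono r \<longrightarrow>
    (\<exists>\<nu> :: real measure.
       \<nu> = density lborel (\<lambda>x. ennreal (frank_density \<alpha> x)) \<and>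
       \<nu> \<in> minimizers \<alpha> 2 \<and>
       weakly_converges (\<lambda>k. translate (a (r k)) (\<mu> (r k))) \<nu>)"
proof -
  have \<alpha>: "2 < \<alpha>" "\<alpha> < 3" using assms(1) by auto
  define a where "a m = - (\<integral>x. x \<partial>\<mu> m)" for m
  define \<eta> where "\<eta> m = translate (a m) (\<mu> m)" for m
  have \<eta>: "\<eta> m \<in> finite_moment \<alpha>" "(\<integral>x. x \<partial>\<eta> m) = 0"
    "energy_real \<alpha> (\<beta> m) (\<eta> m) (\<eta> m) \<le> energy_real \<alpha> (\<beta> m) (frank_measure \<alpha>) (frank_measure \<alpha>)" for m
    unfolding \<eta>_def a_def using centred_minimizer[OF \<alpha> assms(2) assms(4)] by blast+
  have dist: "real_distribution (\<eta> m)" "real_distribution (frank_measure \<alpha>)" for m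
    using finite_momentD(5) \<eta>(1) frank_measure_finite_moment[OF \<alpha>] by blast+
  have "weak_conv_m \<eta> (frank_measure \<alpha>)"
    by (rule levy_continuity[OF dist]) (rule centred_minimizers_char_convergence[OF \<alpha> assms(3) \<eta>])
  hence conv: "(\<lambda>m. \<integral>x. f x \<partial>\<eta> m) \<longlonglongrightarrow> (\<integral>x. f x \<partial>frank_measure \<alpha>)"
    if f: "continuous_on UNIV f" "bounded (range f)" for f :: "real \<Rightarrow> real"
  proof -
    obtain C where "\<And>x. norm (f x) \<le> C" using f(2) by (auto simp: bounded_iff)
    moreover have "isCont f x" for x using f(1) by (simp add: continuous_on_eq_continuous_at)
    ultimately show ?thesis
      using weak_conv_imp_integral_bdd_continuous_conv[OF dist \<open>weak_conv_m \<eta> (frank_measure \<alpha>)\<close>]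
      by blast
  qed
  show ?thesis
  proof (intro exI[of _ a] allI impI exI[of _ "frank_measure \<alpha>"] conjI)
    fix r :: "nat \<Rightarrow> nat" assume r: "strict_mono r"
    show "frank_measure \<alpha> = density lborel (\<lambda>x. ennreal (frank_density \<alpha> x))"
      by (simp add: frank_measure_def)
    show "frank_measure \<alpha> \<in> minimizers \<alpha> 2" by (rule frank_measure_minimizer[OF \<alpha>])
    show "weakly_converges (\<lambda>k. translate (a (r k)) (\<mu> (r k))) (frank_measure \<alpha>)"
      unfolding weakly_converges_def \<eta>_def[symmetric]
      using LIMSEQ_subseq_LIMSEQ[OF conv r] by (auto simp: o_def)
  qed
qed

end
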